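(* For every real number $\varepsilon>0$ there is $N$ such that for every $n\ge N$ there exists a $7n$-almost supermagic edge labeling $t=t_n$ of $K_n$ such that $r(p,t)\le \frac12+\varepsilon$ for every admissible $p$.
   Context: $K_n$ is the complete graph on $n$ vertices; $\epsilon_n=\binom n2$ is its number of edges and $[a]=\{1,\dots,a\}$. For a vertex $v$, $D(v)$ is the set of edges containing $v$. An edge labeling of a graph with edge set $E$ is a bijection $t:E\to[|E|]$. For a vertex $v$, $s(t,v)=\sum_{e\in D(v)}t(e)$. A labeling $t$ is $\alpha$-almost supermagic if $|s(t,u)-s(t,v)|\le\alpha$ for all vertices $u,v$. For a positive integer $p$, a $p$-swap of $t$ is a map $\theta$ sending $t$ to another edge labeling $\theta t$ of the same graph with $|t(e)-\theta t(e)|\le p$ for every edge $e$. $R(p,t,n)=\max_{\theta}\max_{u\ne v}|s(\theta t,u)-s(\theta t,v)|$, the outer maximum over all $p$-swaps $\theta$ of the labeling $t$ of $K_n$. For a family $t=(t_n)$ of labelings of $K_n$ and $p=p(n)$, the $p$-robustness ratio is $r(p,t)=\limsup_{n\to\infty}R(p,t_n,n)/(2pn)$. The magnitude $p=p(n)$ is admissible if $p(n)=o(n)$ and $p(n)\to\infty$. *)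

theory Defs
  imports Complex_Main "HOL-Library.Extended_Real" "HOL-Library.Landau_Symbols"
begin

text \<open>An undirected edge is the two-element set of its ends; the graph \<open>K\<^sub>n\<close> has vertex set
  \<open>{1..n}\<close>.\<close>

definition complete_edges :: "nat \<Rightarrow> nat set set" where
  "complete_edges n = {e. e \<subseteq> {1..n} \<and> card e = 2}"

definition incident_edges :: "nat set set \<Rightarrow> nat \<Rightarrow> nat set set" where
  "incident_edges E v = {e \<in> E. v \<in> e}"

text \<open>Only the values of a labeling on the edge set matter: two functions that agree on \<open>E\<close>
  represent the same labeling.\<close>

definition edge_labeling :: "nat set set \<Rightarrow> (nat set \<Rightarrow> nat) \<Rightarrow> bool" where
  "edge_labeling E t \<longleftrightarrow> bij_betw t E {1..card E}"

definition vertex_sum :: "nat set set \<Rightarrow> (nat set \<Rightarrow> nat) \<Rightarrow> nat \<Rightarrow> nat" where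
  "vertex_sum E t v = (\<Sum>e\<in>incident_edges E v. t e)"

definition almost_supermagic :: "nat set \<Rightarrow> nat set set \<Rightarrow> real \<Rightarrow> (nat set \<Rightarrow> nat) \<Rightarrow> bool" where
  "almost_supermagic V E \<alpha> t \<longleftrightarrow>
     (\<forall>u\<in>V. \<forall>v\<in>V. \<bar>real (vertex_sum E t u) - real (vertex_sum E t v)\<bar> \<le> \<alpha>)"

text \<open>A \<open>p\<close>-swap is identified with the labeling it produces; the identity swap is allowed.\<close>

definition swap_results :: "nat set set \<Rightarrow> nat \<Rightarrow> (nat set \<Rightarrow> nat) \<Rightarrow> (nat set \<Rightarrow> nat) set" where
  "swap_results E p t =
     {t'. edge_labeling E t' \<and> (\<forall>e\<in>E. \<bar>int (t e) - int (t' e)\<bar> \<le> int p)}"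

definition max_sum_gap :: "nat set \<Rightarrow> nat set set \<Rightarrow> (nat set \<Rightarrow> nat) \<Rightarrow> real" where
  "max_sum_gap V E t =
     Max {\<bar>real (vertex_sum E t u) - real (vertex_sum E t v)\<bar> | u v. u \<in> V \<and> v \<in> V \<and> u \<noteq> v}"

text \<open>Both maxima are over finite sets of reals, nonempty when \<open>n \<ge> 2\<close> and \<open>t\<close> is an edge
  labeling of \<open>K\<^sub>n\<close>; for other arguments the value is irrelevant.\<close>

definition robustness :: "nat \<Rightarrow> (nat set \<Rightarrow> nat) \<Rightarrow> nat \<Rightarrow> real" where
  "robustness p t n =
     Max (max_sum_gap {1..n} (complete_edges n) ` swap_results (complete_edges n) p t)"

definition robustness_ratio :: "(nat \<Rightarrow> nat) \<Rightarrow> (nat \<Rightarrow> nat set \<Rightarrow> nat) \<Rightarrow> ereal" where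
  "robustness_ratio p t =
     limsup (\<lambda>n. ereal (robustness (p n) (t n) n / (2 * real (p n) * real n)))"

text \<open>Divergence makes \<open>p n\<close> positive for all large \<open>n\<close>, which is all that the limit superior
  depends on.\<close>

definition admissible :: "(nat \<Rightarrow> nat) \<Rightarrow> bool" where
  "admissible p \<longleftrightarrow>
     (\<lambda>n. real (p n)) \<in> o(\<lambda>n. real n) \<and> filterlim p at_top sequentially"

end

theory Submission
  imports Defs "HOL-Library.Disjoint_Sets"
begin

text \<open>
  The robustness comes from contiguity. At most \<open>p\<close> labels can cross a given cut of the label
  range in either direction, so a \<open>p\<close>-swap changes the sum over edges whose labels
  form an interval by \<open>O(p\<^sup>2)\<close> only, however long the interval is. If about half of the edges at
  every vertex lie in boundedly many such intervals, then a vertex sum changes by at most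
  \<open>pn/2 + O(p\<^sup>2 + p)\<close>, hence a difference of two sums by \<open>pn + o(pn)\<close>.

  To get this, cut the vertices into quadruples (and at most three remaining vertices) and orient the
  pairs of quadruples as a tournament with nearly equal scores. A quadruple \<open>u\<^sub>0, \<dots>, u\<^sub>3\<close> and the set
  of all vertices it beats, split into two halves of size \<open>h\<close>, span a complete bipartite graph; the
  \<open>c\<close>-th edge from \<open>u\<^sub>i\<close> to the half \<open>\<tau> = \<plusminus>1\<close> receives, relative to the middle of the label range, the value
  \<open>\<sigma>\<^sub>i \<tau> (b + i h + c)\<close> with signs \<open>\<sigma> = (+, -, -, +)\<close>. These cancel at every vertex because \<open>\<Sum>\<sigma>\<^sub>i = \<Sum>\<sigma>\<^sub>i i = 0\<close>.
  The same pattern with the two sides exchanged treats a pair of remaining vertices. Only the edges inside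
  the classes (at most three at each vertex) and the star of one possible last vertex do not cancel;
  they receive the labels nearest to the middle.
\<close>

section \<open>Centred labelings and zero-sum blocks\<close>

text \<open>Labels are doubled and shifted to be symmetric about 0, so that new edges can be added on both
  sides without changing the old values; for \<open>m\<close> edges the label is \<open>(y e + m + 1) / 2\<close>.\<close>

definition centred :: "'e set \<Rightarrow> ('e \<Rightarrow> int) \<Rightarrow> bool" where
  "centred E y \<longleftrightarrow> finite E \<and>
     bij_betw y E {z. \<bar>z\<bar> < int (card E) \<and> odd (z + int (card E))}"

text \<open>A step of 2 between doubled values is a step of 1 between labels.\<close>

definition run :: "('e \<Rightarrow> int) \<Rightarrow> 'e set \<Rightarrow> bool" where
  "run y F \<longleftrightarrow> (\<exists>a h. y ` F = (\<lambda>j. a + 2 * int j) ` {..<h})"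

text \<open>Disjointness lets the displacement of \<open>S\<close> be added up over its runs. Four
  is the largest number of runs that occurs: a star at one of two remaining vertices needs four, a
  star at a vertex of a quadruple only two.\<close>

definition segmented :: "('e \<Rightarrow> int) \<Rightarrow> 'e set \<Rightarrow> bool" where
  "segmented y S \<longleftrightarrow>
     (\<exists>\<F>. finite \<F> \<and> card \<F> \<le> 4 \<and> disjoint \<F> \<and> \<Union>\<F> = S \<and> (\<forall>F\<in>\<F>. run y F))"

text \<open>Quantifying over all \<open>E\<close> and \<open>y\<close> makes a block independent of
  what it is placed around, so that blocks can be stacked outwards one after another. The family
  \<open>\<S>\<close> lists the edge sets, later stars of vertices, that must come out
  segmented.\<close>

definition magic_block :: "'v set set \<Rightarrow> 'v set set set \<Rightarrow> bool" where
  "magic_block P \<S> \<longleftrightarrow> (\<forall>S\<in>\<S>. S \<subseteq> P) \<and>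
     (\<forall>E y. centred E y \<longrightarrow> E \<inter> P = {} \<longrightarrow>
        (\<exists>y'. centred (E \<union> P) y' \<and> (\<forall>e\<in>E. y' e = y e) \<and>
              (\<forall>v. (\<Sum>e | e \<in> P \<and> v \<in> e. y' e) = 0) \<and> (\<forall>S\<in>\<S>. segmented y' S)))"

lemma magic_blockE:
  assumes "magic_block P \<S>" "centred E y" "E \<inter> P = {}"
  obtains y' where "centred (E \<union> P) y'" "\<forall>e\<in>E. y' e = y e"
    "\<forall>v. (\<Sum>e | e \<in> P \<and> v \<in> e. y' e) = 0" "\<forall>S\<in>\<S>. segmented y' S"
  using assms(1)[unfolded magic_block_def, THEN conjunct2, rule_format, OF assms(2,3)] by auto

lemma run_cong: "run y F \<longleftrightarrow> run y' F" if "\<And>e. e \<in> F \<Longrightarrow> y e = y' e"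
  using that unfolding run_def by (metis image_cong)

lemma segmented_cong: "segmented y S \<longleftrightarrow> segmented y' S" if "\<And>e. e \<in> S \<Longrightarrow> y e = y' e"
proof -
  have "run y F \<longleftrightarrow> run y' F" if "F \<in> \<F>" "\<Union>\<F> = S" for F \<F>
    by (rule run_cong) (use that \<open>\<And>e. e \<in> S \<Longrightarrow> y e = y' e\<close> in auto)
  then show ?thesis unfolding segmented_def by metis
qed

section \<open>Extending a centred labeling by pairs of opposite values\<close>

lemma card_symmetric_odd:
  "card {z::int. \<bar>z\<bar> < int N \<and> odd (z + int N)} = N"
  "finite {z::int. \<bar>z\<bar> < int N \<and> odd (z + int N)}"
proof -
  have "bij_betw (\<lambda>i. 2 * int i + 1 - int N) {..<N} {z::int. \<bar>z\<bar> < int N \<and> odd (z + int N)}"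
  proof (rule bij_betwI[where g = "\<lambda>z. nat ((z + int N - 1) div 2)"])
    show "(\<lambda>i. 2 * int i + 1 - int N) \<in> {..<N} \<rightarrow> {z. \<bar>z\<bar> < int N \<and> odd (z + int N)}"
      by auto
    show "(\<lambda>z. nat ((z + int N - 1) div 2)) \<in> {z. \<bar>z\<bar> < int N \<and> odd (z + int N)} \<rightarrow> {..<N}"
      by auto
    show "nat ((2 * int i + 1 - int N + int N - 1) div 2) = i" if "i \<in> {..<N}" for i
      by simp
    show "2 * int (nat ((z + int N - 1) div 2)) + 1 - int N = z"
      if "z \<in> {z. \<bar>z\<bar> < int N \<and> odd (z + int N)}" for z
      using that by (auto elim!: oddE)
  qed
  from bij_betw_same_card[OF this] bij_betw_finite[OF this]
  show "card {z::int. \<bar>z\<bar> < int N \<and> odd (z + int N)} = N"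
    "finite {z::int. \<bar>z\<bar> < int N \<and> odd (z + int N)}" by auto
qed

lemma ex_centred:
  assumes "finite E" shows "\<exists>y. centred E y"
  using finite_same_card_bij[OF assms card_symmetric_odd(2)[of "card E"]] assms card_symmetric_odd(1)
  unfolding centred_def by metis

text \<open>Adding an even number \<open>2 * k\<close> of edges keeps the parity condition, so the
  old values stay admissible. The values that become available are \<open>N + 1 + 2 * j\<close> with
  both signs, for \<open>j < k\<close>, where \<open>N\<close> is the old number of edges;
  \<open>e j True\<close> and \<open>e j False\<close> receive an opposite pair.\<close>

lemma centred_extend:
  fixes e :: "nat \<Rightarrow> bool \<Rightarrow> 'e"
  assumes y: "centred E y"
    and inj: "inj_on (\<lambda>(j, b). e j b) ({..<k} \<times> UNIV)"
    and P: "P = (\<lambda>(j, b). e j b) ` ({..<k} \<times> UNIV)"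
    and disj: "E \<inter> P = {}"
  obtains y' where "centred (E \<union> P) y'" "\<And>x. x \<in> E \<Longrightarrow> y' x = y x"
    "\<And>j b. j < k \<Longrightarrow> y' (e j b) = (if b then 1 else -1) * (int (card E) + 1 + 2 * int j)"
proof -
  define N where "N = int (card E)"
  define w where "w = (\<lambda>(j, b). (if b then 1 else -1) * (N + 1 + 2 * int j))"
  define g where "g = inv_into ({..<k} \<times> UNIV) (\<lambda>(j, b). e j b)"
  define y' where "y' = (\<lambda>x. if x \<in> E then y x else w (g x))"
  have finE: "finite E" and bijE: "bij_betw y E {z. \<bar>z\<bar> < N \<and> odd (z + N)}"
    using y unfolding centred_def N_def by auto
  have ge: "g (e j b) = (j, b)" if "j < k" for j b
    using inv_into_f_f[OF inj, of "(j, b)"] that by (simp add: g_def)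
  have new: "e j b \<notin> E" if "j < k" for j b
    using disj P that by auto
  have y'e: "y' (e j b) = w (j, b)" if "j < k" for j b
    using new ge that by (simp add: y'_def)
  have cardP: "card P = 2 * k"
    unfolding P card_image[OF inj] by simp
  have finP: "finite P" unfolding P by simp
  have cardEP: "int (card (E \<union> P)) = N + 2 * int k"
    using card_Un_disjoint[OF finE finP disj] cardP by (simp add: N_def)
  have "bij_betw y' E {z. \<bar>z\<bar> < N \<and> odd (z + N)}"
    using bijE by (rule bij_betw_cong[THEN iffD1, rotated]) (simp add: y'_def)
  moreover have "bij_betw y' P {z. N \<le> \<bar>z\<bar> \<and> \<bar>z\<bar> < N + 2 * int k \<and> odd (z + N)}"
  proof -
    have N0: "N \<ge> 0" by (simp add: N_def)
    have "bij_betw w ({..<k} \<times> UNIV) {z. N \<le> \<bar>z\<bar> \<and> \<bar>z\<bar> < N + 2 * int k \<and> odd (z + N)}"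
    proof (rule bij_betwI[where g = "\<lambda>z. (nat ((\<bar>z\<bar> - N - 1) div 2), z > 0)"])
      show "w \<in> {..<k} \<times> UNIV \<rightarrow> {z. N \<le> \<bar>z\<bar> \<and> \<bar>z\<bar> < N + 2 * int k \<and> odd (z + N)}"
        using N0 by (auto simp: w_def split: if_splits)
      show "(\<lambda>z. (nat ((\<bar>z\<bar> - N - 1) div 2), z > 0))
          \<in> {z. N \<le> \<bar>z\<bar> \<and> \<bar>z\<bar> < N + 2 * int k \<and> odd (z + N)} \<rightarrow> {..<k} \<times> UNIV"
        using N0 by auto
      show "(nat ((\<bar>w x\<bar> - N - 1) div 2), 0 < w x) = x" if "x \<in> {..<k} \<times> UNIV" for x
        using N0 by (cases x) (auto simp: w_def)
      show "w (nat ((\<bar>z\<bar> - N - 1) div 2), 0 < z) = z"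
        if "z \<in> {z. N \<le> \<bar>z\<bar> \<and> \<bar>z\<bar> < N + 2 * int k \<and> odd (z + N)}" for z
      proof -
        \<comment> \<open>Parity rules out the boundary value, so the inverse formula never
          truncates a negative number.\<close>
        have "\<bar>z\<bar> \<noteq> N" using that by (auto simp: abs_if split: if_splits)
        then have ge: "\<bar>z\<bar> - N - 1 \<ge> 0" using that by auto
        have "even (\<bar>z\<bar> - N - 1)" using that by (auto simp: abs_if)
        then have "2 * ((\<bar>z\<bar> - N - 1) div 2) = \<bar>z\<bar> - N - 1" by simp
        then show ?thesis using ge N0 by (auto simp: w_def)
      qed
    qed
    moreover have "bij_betw g P ({..<k} \<times> UNIV)"
      unfolding g_def P by (rule bij_betw_inv_into) (simp add: inj inj_on_imp_bij_betw)
    ultimately have "bij_betw (w \<circ> g) P {z. N \<le> \<bar>z\<bar> \<and> \<bar>z\<bar> < N + 2 * int k \<and> odd (z + N)}"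
      by (rule bij_betw_trans[rotated])
    then show ?thesis
      by (rule bij_betw_cong[THEN iffD1, rotated]) (use disj in \<open>auto simp: y'_def\<close>)
  qed
  ultimately have "bij_betw y' (E \<union> P) ({z. \<bar>z\<bar> < N \<and> odd (z + N)} \<union>
      {z. N \<le> \<bar>z\<bar> \<and> \<bar>z\<bar> < N + 2 * int k \<and> odd (z + N)})"
    by (rule bij_betw_combine) auto
  also have "{z. \<bar>z\<bar> < N \<and> odd (z + N)} \<union> {z. N \<le> \<bar>z\<bar> \<and> \<bar>z\<bar> < N + 2 * int k \<and> odd (z + N)}
      = {z. \<bar>z\<bar> < int (card (E \<union> P)) \<and> odd (z + int (card (E \<union> P)))}"
    unfolding cardEP by auto
  finally have "centred (E \<union> P) y'"
    unfolding centred_def using finE finP by auto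
  then show ?thesis
    by (rule that) (auto simp: y'_def[of] y'e w_def N_def new ge)
qed

section \<open>Stacking zero-sum blocks\<close>

lemma magic_block_empty: "magic_block {} {}"
  unfolding magic_block_def by auto

text \<open>\<open>Q\<close> is placed around \<open>E \<union> P\<close>. This leaves the values on
  \<open>P\<close> untouched, so both the zero sums and the segments obtained for \<open>P\<close>
  survive, and the sums at a vertex add.\<close>

lemma magic_block_Un:
  assumes P: "magic_block P \<S>" and Q: "magic_block Q \<T>" and disj: "P \<inter> Q = {}"
  shows "magic_block (P \<union> Q) (\<S> \<union> \<T>)"
  unfolding magic_block_def
proof (intro conjI allI impI)
  show "\<forall>S\<in>\<S> \<union> \<T>. S \<subseteq> P \<union> Q"
    using P Q unfolding magic_block_def by blast
  fix E and y :: "'a set \<Rightarrow> int"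
  assume y: "centred E y" and E: "E \<inter> (P \<union> Q) = {}"
  obtain y1 where y1: "centred (E \<union> P) y1" "\<forall>e\<in>E. y1 e = y e"
    "\<forall>v. (\<Sum>e | e \<in> P \<and> v \<in> e. y1 e) = 0" "\<forall>S\<in>\<S>. segmented y1 S"
  proof -
    have "E \<inter> P = {}" using E by auto
    from magic_blockE[OF P y this] show ?thesis using that .
  qed
  have "(E \<union> P) \<inter> Q = {}" using E disj by auto
  from magic_blockE[OF Q y1(1) this] obtain y2 where y2: "centred (E \<union> P \<union> Q) y2" "\<forall>e\<in>E \<union> P. y2 e = y1 e"
    "\<forall>v. (\<Sum>e | e \<in> Q \<and> v \<in> e. y2 e) = 0" "\<forall>S\<in>\<T>. segmented y2 S"
    .
  have fin: "finite P" "finite Q" using y2(1) unfolding centred_def by auto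
  have "(\<Sum>e | e \<in> P \<union> Q \<and> v \<in> e. y2 e) = 0" for v
  proof -
    have "{e. e \<in> P \<union> Q \<and> v \<in> e} = {e. e \<in> P \<and> v \<in> e} \<union> {e. e \<in> Q \<and> v \<in> e}" by auto
    then have "(\<Sum>e | e \<in> P \<union> Q \<and> v \<in> e. y2 e)
        = (\<Sum>e | e \<in> P \<and> v \<in> e. y2 e) + (\<Sum>e | e \<in> Q \<and> v \<in> e. y2 e)"
      by (simp only:) (rule sum.union_disjoint, use fin disj in auto)
    also have "(\<Sum>e | e \<in> P \<and> v \<in> e. y2 e) = (\<Sum>e | e \<in> P \<and> v \<in> e. y1 e)"
      by (rule sum.cong) (use y2(2) in auto)
    finally show ?thesis using y1(3) y2(3) by simp
  qed
  moreover have "segmented y2 S" if "S \<in> \<S>" for S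
  proof -
    have "S \<subseteq> P" using P that unfolding magic_block_def by blast
    then have "segmented y2 S \<longleftrightarrow> segmented y1 S"
      by (intro segmented_cong) (use y2(2) in auto)
    then show ?thesis using y1(4) that by blast
  qed
  ultimately show "\<exists>y'. centred (E \<union> (P \<union> Q)) y' \<and> (\<forall>e\<in>E. y' e = y e) \<and>
      (\<forall>v. (\<Sum>e | e \<in> P \<union> Q \<and> v \<in> e. y' e) = 0) \<and> (\<forall>S\<in>\<S> \<union> \<T>. segmented y' S)"
    using y1 y2 by (intro exI[of _ y2]) (auto simp: Un_assoc)
qed

lemma magic_block_UN:
  assumes "finite I" "\<And>i. i \<in> I \<Longrightarrow> magic_block (P i) (\<S> i)" "disjoint_family_on P I"
  shows "magic_block (\<Union>i\<in>I. P i) (\<Union>i\<in>I. \<S> i)"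
  using assms
proof (induction I rule: finite_induct)
  case empty
  then show ?case by (simp add: magic_block_empty)
next
  case (insert i I)
  have "P i \<inter> (\<Union>j\<in>I. P j) = {}"
    using insert.hyps insert.prems(2) unfolding disjoint_family_on_def by auto
  moreover have "disjoint_family_on P I"
    using insert.prems(2) unfolding disjoint_family_on_def by auto
  ultimately show ?case
    using magic_block_Un[of "P i" "\<S> i"] insert by auto
qed

section \<open>The block of four rows with signs +, -, -, +\<close>

lemma runI:
  assumes "\<And>c. c < h \<Longrightarrow> y (f c) = (if b then 1 else -1) * (a + 2 * int c)"
  shows "run y (f ` {..<h})"
proof (cases b)
  case True
  then have "y ` f ` {..<h} = (\<lambda>j. a + 2 * int j) ` {..<h}"
    unfolding image_image by (intro image_cong) (auto simp: assms)
  then show ?thesis unfolding run_def by blast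
next
  case False
  \<comment> \<open>With the negative sign the values decrease in \<open>c\<close>; reversing the
    index turns them into an increasing progression of step 2.\<close>
  have rev: "{..<h} = (\<lambda>j. h - 1 - j) ` {..<h}"
  proof (intro subset_antisym subsetI)
    fix x assume "x \<in> {..<h}"
    then have "x = h - 1 - (h - 1 - x)" "h - 1 - x \<in> {..<h}" by auto
    then show "x \<in> (\<lambda>j. h - 1 - j) ` {..<h}" by (rule image_eqI)
  qed auto
  have "y ` f ` {..<h} = (\<lambda>c. - (a + 2 * int c)) ` {..<h}"
    unfolding image_image by (intro image_cong) (auto simp: assms False)
  also have "\<dots> = (\<lambda>c. - (a + 2 * int c)) ` (\<lambda>j. h - 1 - j) ` {..<h}"
    by (subst rev) (rule refl)
  also have "\<dots> = (\<lambda>j. - (a + 2 * (int h - 1)) + 2 * int j) ` {..<h}"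
    unfolding image_image by (intro image_cong) auto
  finally show ?thesis unfolding run_def by blast
qed

lemma block_index_less: "i * h + c < k * h" if "i < k" "c < h" for i h c k :: nat
proof -
  have "i * h + c < (i + 1) * h" using that by simp
  also have "\<dots> \<le> k * h" using that by (intro mult_right_mono) auto
  finally show ?thesis .
qed

text \<open>The edge in row \<open>i\<close>, side \<open>b\<close>, column \<open>c\<close> gets
  absolute value \<open>N + 1 + 2 * (i * h + c)\<close>, and switching the side switches the sign.
  The two alternatives in \<open>inc\<close> are the two ways to cancel at a vertex: it lies on both
  edges of each opposite pair or on neither, or its membership does not depend on the row, and then
  the four rows cancel for each side and column. Each row on one side is a single run, which gives
  the segmented unions.\<close>

lemma magic_block_four:
  fixes e :: "nat \<Rightarrow> bool \<Rightarrow> nat \<Rightarrow> 'v set"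
  assumes inj: "inj_on (\<lambda>(i, b, c). e i b c) ({..<4} \<times> UNIV \<times> {..<h})"
    and P: "P = (\<lambda>(i, b, c). e i b c) ` ({..<4} \<times> UNIV \<times> {..<h})"
    and inc: "\<And>v. (\<forall>i<4. \<forall>c<h. v \<in> e i True c \<longleftrightarrow> v \<in> e i False c) \<or>
                  (\<forall>b. \<forall>c<h. \<forall>i<4. v \<in> e i b c \<longleftrightarrow> v \<in> e 0 b c)"
  shows "magic_block P {S. \<exists>K \<subseteq> {..<4} \<times> UNIV. card K \<le> 4 \<and> S = (\<Union>(i, b)\<in>K. e i b ` {..<h})}"
    (is "magic_block P ?\<S>")
  unfolding magic_block_def
proof (intro conjI allI impI)
  show "\<forall>S\<in>?\<S>. S \<subseteq> P"
    unfolding P by (fastforce simp: image_iff)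
  fix E and y :: "'v set \<Rightarrow> int"
  assume y: "centred E y" and E: "E \<inter> P = {}"
  define N where "N = int (card E)"
  define pos where "pos i = (i = 0 \<or> i = (3::nat))" for i
  \<comment> \<open>Re-indexing for \<open>centred_extend\<close>: \<open>j\<close> stands for
    \<open>i * h + c\<close>, and the boolean now is the actual sign, which agrees with the side in
    rows 0 and 3 and is opposite to it in rows 1 and 2.\<close>
  define e' where "e' j b = e (j div h) (b = pos (j div h)) (j mod h)" for j b
  have idx: "j div h < 4" "j mod h < h" if "j < 4 * h" for j
    using that by (auto simp: less_mult_imp_div_less intro!: mod_less_divisor gr0I)
  have e'_eq: "e' (i * h + c) (b = pos i) = e i b c" if "c < h" for i b c
    using that by (cases "pos i") (simp_all add: e'_def)
  have inj': "inj_on (\<lambda>(j, b). e' j b) ({..<4 * h} \<times> UNIV)"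
  proof (rule inj_onI, clarify)
    fix j b j' b' assume j: "j < 4 * h" "j' < 4 * h" and eq: "e' j b = e' j' b'"
    have "(j div h, (b = pos (j div h)), j mod h) = (j' div h, (b' = pos (j' div h)), j' mod h)"
      using inj_onD[OF inj, of "(j div h, (b = pos (j div h)), j mod h)"
          "(j' div h, (b' = pos (j' div h)), j' mod h)"] eq idx j
      by (auto simp: e'_def)
    then have "j div h = j' div h" "j mod h = j' mod h" "b = b'" by auto
    then show "j = j' \<and> b = b'" by (metis div_mult_mod_eq)
  qed
  have P': "P = (\<lambda>(j, b). e' j b) ` ({..<4 * h} \<times> UNIV)"
  proof (intro set_eqI iffI)
    fix x assume "x \<in> P"
    then obtain i b c where "i < 4" "c < h" "x = e i b c" unfolding P by auto
    then show "x \<in> (\<lambda>(j, b). e' j b) ` ({..<4 * h} \<times> UNIV)"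
      using e'_eq[of c i b] block_index_less[of i 4 c h] by (force simp: image_iff)
  next
    fix x assume "x \<in> (\<lambda>(j, b). e' j b) ` ({..<4 * h} \<times> UNIV)"
    then obtain j b where "j < 4 * h" "x = e' j b" by auto
    then show "x \<in> P" unfolding P e'_def using idx[of j] by (force simp: image_iff)
  qed
  obtain y' where y': "centred (E \<union> P) y'" "\<And>x. x \<in> E \<Longrightarrow> y' x = y x"
    "\<And>j b. j < 4 * h \<Longrightarrow> y' (e' j b) = (if b then 1 else -1) * (N + 1 + 2 * int j)"
    using centred_extend[OF y inj' P' E] unfolding N_def by blast
  have val: "y' (e i b c) = (if b = pos i then 1 else -1) * (N + 1 + 2 * int (i * h + c))"
    if "i < 4" "c < h" for i b c
    using y'(3)[OF block_index_less[OF that], of "b = pos i"] e'_eq[OF that(2), of i b] by simp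
  have "(\<Sum>x | x \<in> P \<and> v \<in> x. y' x) = 0" for v
  proof -
    define f where "f i b c = (if v \<in> e i b c then y' (e i b c) else 0)" for i b c
    have finP: "finite P" unfolding P by simp
    have "(\<Sum>x | x \<in> P \<and> v \<in> x. y' x) = (\<Sum>x\<in>P. if v \<in> x then y' x else 0)"
      using finP by (simp add: sum.inter_filter)
    also have "\<dots> = (\<Sum>(i, b, c)\<in>{..<4} \<times> UNIV \<times> {..<h}. f i b c)"
      unfolding P by (subst sum.reindex[OF inj]) (auto intro!: sum.cong simp: f_def)
    also have "\<dots> = (\<Sum>i<4. \<Sum>b\<in>UNIV. \<Sum>c<h. f i b c)"
      by (simp add: sum.cartesian_product)
    also have "\<dots> = 0"
      using inc[of v]
    proof
      assume *: "\<forall>i<4. \<forall>c<h. v \<in> e i True c \<longleftrightarrow> v \<in> e i False c"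
      have "(\<Sum>b\<in>UNIV. \<Sum>c<h. f i b c) = 0" if "i < 4" for i
      proof -
        have "(\<Sum>c<h. f i False c) = (\<Sum>c<h. - f i True c)"
          by (rule sum.cong) (use * that in \<open>auto simp: f_def val\<close>)
        then show ?thesis by (simp add: UNIV_bool sum_negf)
      qed
      then show ?thesis by simp
    next
      assume *: "\<forall>b. \<forall>c<h. \<forall>i<4. v \<in> e i b c \<longleftrightarrow> v \<in> e 0 b c"
      \<comment> \<open>The four signs sum to 0, and so do the signed row offsets, because 0 - 1 - 2
        + 3 = 0.\<close>
      have "(\<Sum>i<4. f i b c) = 0" if "c < h" for b c
      proof -
        have "f i b c = (if v \<in> e 0 b c then y' (e i b c) else 0)" if "i < 4" for i
          unfolding f_def by (subst *[rule_format, OF \<open>c < h\<close> that]) (rule refl)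
        moreover have "(\<Sum>i<4. f i b c) = f 0 b c + f 1 b c + f 2 b c + f 3 b c"
          by (simp add: eval_nat_numeral)
        ultimately show ?thesis
          by (cases b) (simp_all add: val that pos_def)
      qed
      then have "(\<Sum>b\<in>UNIV. \<Sum>c<h. \<Sum>i<4. f i b c) = 0" by simp
      moreover have "(\<Sum>i<4. \<Sum>b\<in>UNIV. \<Sum>c<h. f i b c) = (\<Sum>b\<in>UNIV. \<Sum>i<4. \<Sum>c<h. f i b c)"
        by (rule sum.swap)
      moreover have "\<dots> = (\<Sum>b\<in>UNIV. \<Sum>c<h. \<Sum>i<4. f i b c)"
        by (intro sum.cong refl sum.swap)
      ultimately show ?thesis by simp
    qed
    finally show ?thesis .
  qed
  moreover have "segmented y' S" if S: "S \<in> ?\<S>" for S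
  proof -
    obtain K where K: "K \<subseteq> {..<4} \<times> UNIV" "card K \<le> 4" "S = (\<Union>(i, b)\<in>K. e i b ` {..<h})"
      using S by auto
    define \<F> where "\<F> = (\<lambda>(i, b). e i b ` {..<h}) ` K"
    have finK: "finite K" using K(1) by (rule finite_subset) auto
    have rep: "\<exists>i b. i < 4 \<and> F = e i b ` {..<h}" if F: "F \<in> \<F>" for F
    proof -
      obtain i b where "(i, b) \<in> K" "F = e i b ` {..<h}" using F by (auto simp: \<F>_def)
      moreover from this have "i < 4" using K(1) by auto
      ultimately show ?thesis by blast
    qed
    have "disjoint \<F>"
    proof (rule disjointI)
      fix F F' assume "F \<in> \<F>" "F' \<in> \<F>" and ne: "F \<noteq> F'"
      then obtain i b i' b' where *: "i < 4" "i' < 4" "F = e i b ` {..<h}" "F' = e i' b' ` {..<h}"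
        using rep by meson
      have "False" if "c < h" "c' < h" "e i b c = e i' b' c'" for c c'
        using inj_onD[OF inj, of "(i, b, c)" "(i', b', c')"] that * ne by auto
      then show "F \<inter> F' = {}" using * by auto
    qed
    moreover have "run y' F" if "F \<in> \<F>" for F
    proof -
      obtain i b where *: "i < 4" "F = e i b ` {..<h}"
        using rep[OF \<open>F \<in> \<F>\<close>] by auto
      show ?thesis
        unfolding *(2)
      proof (rule runI[where b = "b = pos i" and a = "N + 1 + 2 * int (i * h)"])
        show "y' (e i b c) = (if b = pos i then 1 else -1) * (N + 1 + 2 * int (i * h) + 2 * int c)"
          if "c < h" for c
          using val[OF *(1) that, of b] by simp
      qed
    qed
    ultimately show ?thesis
      unfolding segmented_def
      using K finK card_image_le[OF finK, of "\<lambda>(i, b). e i b ` {..<h}"]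
      by (intro exI[of _ \<F>]) (auto simp: \<F>_def)
  qed
  ultimately show "\<exists>y'. centred (E \<union> P) y' \<and> (\<forall>e\<in>E. y' e = y e) \<and>
      (\<forall>v. (\<Sum>e | e \<in> P \<and> v \<in> e. y' e) = 0) \<and> (\<forall>S\<in>?\<S>. segmented y' S)"
    using y' by (intro exI[of _ y']) auto
qed


section \<open>Displacement of intervals of labels\<close>

text \<open>Labels common to \<open>I\<close> and \<open>J\<close> cancel. A label in
  \<open>J - I\<close> has crossed the cut upwards and lies in \<open>{b + 1..b + p}\<close>, so
  there are at most \<open>p\<close> of them. The equally many labels in \<open>I - J\<close> also
  lie within \<open>p\<close> of the cut. Measured from \<open>b\<close>, each of the two sums is at
  most \<open>p * p\<close> in absolute value.\<close>

lemma prefix_displacement: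
  fixes t t' :: "'e \<Rightarrow> nat"
  assumes t: "bij_betw t E {1..m}" and t': "bij_betw t' E {1..m}" and fin: "finite E"
    and close: "\<And>e. e \<in> E \<Longrightarrow> \<bar>int (t e) - int (t' e)\<bar> \<le> int p"
  shows "\<bar>\<Sum>e | e \<in> E \<and> t e \<le> b. int (t' e) - int (t e)\<bar> \<le> 2 * (int p)\<^sup>2"
proof -
  define S where "S = {e \<in> E. t e \<le> b}"
  define I J where "I = t ` S" and "J = t' ` S"
  have finS: "finite S" using fin by (simp add: S_def)
  have inj: "inj_on t S" "inj_on t' S"
    using t t' by (auto simp: bij_betw_def S_def intro: inj_on_subset)
  have finIJ: "finite I" "finite J" and cardIJ: "card I = card J"
    using finS inj by (auto simp: I_def J_def card_image)
  define k where "k = card (J - I)"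
  have k': "card (I - J) = k"
    using finIJ cardIJ card_Diff_subset_Int[of J I] card_Diff_subset_Int[of I J]
    unfolding k_def by (simp add: Int_commute)
  have JI: "x \<in> {b + 1..b + p}" if x: "x \<in> J - I" for x
  proof -
    obtain e where e: "e \<in> E" "t e \<le> b" "x = t' e" using x by (auto simp: J_def S_def)
    obtain e' where "e' \<in> E" "x = t e'"
      using e(1,3) t t' by (metis bij_betw_def imageE imageI)
    then have "x > b" using x by (auto simp: I_def S_def not_le)
    then show ?thesis using close[OF e(1)] e by auto
  qed
  have IJ: "\<bar>int x - int b\<bar> \<le> int p" if x: "x \<in> I - J" for x
  proof -
    obtain e where e: "e \<in> E" "t e \<le> b" "x = t e" using x by (auto simp: I_def S_def)
    obtain e' where e': "e' \<in> E" "x = t' e'"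
      using e(1,3) t t' by (metis bij_betw_def imageE imageI)
    then have "t e' > b" using x by (auto simp: J_def S_def not_le)
    then show ?thesis using close[OF e'(1)] e e' by auto
  qed
  have "k \<le> card {b + 1..b + p}"
    unfolding k_def by (rule card_mono) (use JI in auto)
  then have kp: "int k \<le> int p" by simp
  have "(\<Sum>e\<in>S. int (t' e) - int (t e)) = (\<Sum>x\<in>J. int x) - (\<Sum>x\<in>I. int x)"
    unfolding I_def J_def sum.reindex[OF inj(1)] sum.reindex[OF inj(2)]
    by (simp add: sum_subtractf)
  also have "\<dots> = (\<Sum>x\<in>J - I. int x) - (\<Sum>x\<in>I - J. int x)"
    using finIJ sum.Int_Diff[of J int I] sum.Int_Diff[of I int J] by (simp add: Int_commute)
  \<comment> \<open>Subtracting \<open>b\<close> from every term is harmless because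
    \<open>J - I\<close> and \<open>I - J\<close> have the same size \<open>k\<close>.\<close>
  also have "\<dots> = (\<Sum>x\<in>J - I. int x - int b) - (\<Sum>x\<in>I - J. int x - int b)"
    using k' by (simp add: sum_subtractf k_def)
  finally have "\<bar>\<Sum>e\<in>S. int (t' e) - int (t e)\<bar>
      \<le> \<bar>\<Sum>x\<in>J - I. int x - int b\<bar> + \<bar>\<Sum>x\<in>I - J. int x - int b\<bar>"
    by linarith
  also have "\<bar>\<Sum>x\<in>J - I. int x - int b\<bar> \<le> (\<Sum>x\<in>J - I. int p)"
    by (rule order.trans[OF sum_abs]) (intro sum_mono, use JI in force)
  also have "\<bar>\<Sum>x\<in>I - J. int x - int b\<bar> \<le> (\<Sum>x\<in>I - J. int p)"
    by (rule order.trans[OF sum_abs]) (intro sum_mono IJ)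
  also have "(\<Sum>x\<in>J - I. int p) + (\<Sum>x\<in>I - J. int p) = 2 * (int k * int p)"
    using k' by (simp add: k_def)
  also have "\<dots> \<le> 2 * (int p * int p)" using kp by (intro mult_left_mono mult_right_mono) auto
  finally show ?thesis by (simp add: S_def power2_eq_square)
qed

text \<open>A run is the set of edges whose labels form an interval, hence a difference of two
  prefixes; each prefix contributes at most \<open>2 * p * p\<close>.\<close>

lemma run_displacement:
  fixes t t' :: "'e \<Rightarrow> nat"
  assumes y: "centred E y" and ty: "\<And>e. e \<in> E \<Longrightarrow> 2 * int (t e) = y e + int (card E) + 1"
    and t: "bij_betw t E {1..card E}" and t': "bij_betw t' E {1..card E}"
    and close: "\<And>e. e \<in> E \<Longrightarrow> \<bar>int (t e) - int (t' e)\<bar> \<le> int p"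
    and F: "F \<subseteq> E" "run y F"
  shows "\<bar>\<Sum>e\<in>F. int (t' e) - int (t e)\<bar> \<le> 4 * (int p)\<^sup>2"
proof (cases "F = {}")
  case False
  have finE: "finite E" and inj: "inj_on y E"
    using y unfolding centred_def bij_betw_def by auto
  obtain a h where ah: "y ` F = (\<lambda>j. a + 2 * int j) ` {..<h}"
    using F(2) unfolding run_def by auto
  with False have "h > 0" by (cases h) auto
  then have "a \<in> y ` F" unfolding ah by force
  then obtain e0 where e0: "e0 \<in> F" "y e0 = a" by auto
  define b where "b = t e0"
  have b: "a = 2 * int b - int (card E) - 1" using ty[of e0] e0 F(1) by (auto simp: b_def)
  have "t e0 \<in> {1..card E}" using t e0 F(1) by (metis bij_betwE subsetD)
  \<comment> \<open>This makes the natural number \<open>b - 1\<close> the true cut just below the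
    run.\<close>
  then have "b \<ge> 1" by (simp add: b_def)
  define A where "A c = {e \<in> E. t e \<le> c}" for c
  have "F = A (b - 1 + h) - A (b - 1)"
  proof (intro set_eqI iffI)
    fix e assume e: "e \<in> F"
    then have "y e \<in> (\<lambda>j. a + 2 * int j) ` {..<h}" unfolding ah[symmetric] by (rule imageI)
    then obtain j where "j < h" "y e = a + 2 * int j" by auto
    then show "e \<in> A (b - 1 + h) - A (b - 1)"
      using ty[of e] e F(1) b \<open>b \<ge> 1\<close> by (auto simp: A_def)
  next
    fix e assume e: "e \<in> A (b - 1 + h) - A (b - 1)"
    then have eE: "e \<in> E" and "t e \<ge> b" "t e < b + h" using \<open>b \<ge> 1\<close> by (auto simp: A_def)
    then have "y e = a + 2 * int (t e - b)" "t e - b < h"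
      using ty[OF eE] b by (auto simp: of_nat_diff)
    then have "y e \<in> y ` F" unfolding ah by blast
    then show "e \<in> F" using inj eE F(1) by (auto dest: inj_onD)
  qed
  moreover have "A (b - 1) \<subseteq> A (b - 1 + h)" by (auto simp: A_def)
  moreover have "finite (A (b - 1 + h))" using finE by (simp add: A_def)
  ultimately have "(\<Sum>e\<in>F. int (t' e) - int (t e))
      = (\<Sum>e\<in>A (b - 1 + h). int (t' e) - int (t e)) - (\<Sum>e\<in>A (b - 1). int (t' e) - int (t e))"
    by (simp only: sum_diff)
  then show ?thesis
    using prefix_displacement[OF t t' finE close, of "b - 1 + h"]
      prefix_displacement[OF t t' finE close, of "b - 1"]
    unfolding A_def by linarith
qed simp

lemma segmented_displacement:
  fixes t t' :: "'e \<Rightarrow> nat"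
  assumes y: "centred E y" and ty: "\<And>e. e \<in> E \<Longrightarrow> 2 * int (t e) = y e + int (card E) + 1"
    and t: "bij_betw t E {1..card E}" and t': "bij_betw t' E {1..card E}"
    and close: "\<And>e. e \<in> E \<Longrightarrow> \<bar>int (t e) - int (t' e)\<bar> \<le> int p"
    and S: "S \<subseteq> E" "segmented y S"
  shows "\<bar>\<Sum>e\<in>S. int (t' e) - int (t e)\<bar> \<le> 16 * (int p)\<^sup>2"
proof -
  obtain \<F> where \<F>: "finite \<F>" "card \<F> \<le> 4" "disjoint \<F>" "\<Union>\<F> = S" "\<And>F. F \<in> \<F> \<Longrightarrow> run y F"
    using S(2) unfolding segmented_def by auto
  have sub: "F \<subseteq> E" if "F \<in> \<F>" for F using that \<F>(4) S(1) by auto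
  have finE: "finite E" using y unfolding centred_def by auto
  have "(\<Sum>e\<in>S. int (t' e) - int (t e)) = (\<Sum>F\<in>\<F>. \<Sum>e\<in>F. int (t' e) - int (t e))"
    unfolding \<F>(4)[symmetric]
    by (subst sum.Union_disjoint)
      (use sub finE \<F>(3) in \<open>auto simp: disjoint_def intro: finite_subset\<close>)
  also have "\<bar>\<dots>\<bar> \<le> (\<Sum>F\<in>\<F>. 4 * (int p)\<^sup>2)"
    by (rule order.trans[OF sum_abs])
      (intro sum_mono run_displacement[OF y ty t t' close] sub \<F>(5))
  also have "\<dots> = int (card \<F>) * (4 * (int p)\<^sup>2)" by simp
  also have "\<dots> \<le> 4 * (4 * (int p)\<^sup>2)" using \<F>(2) by (intro mult_right_mono) auto
  finally show ?thesis by simp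
qed

section \<open>Complete bipartite blocks\<close>

text \<open>For disjoint \<open>A\<close> and \<open>B\<close> this is the edge set of the complete
  bipartite graph; a common element would contribute a singleton.\<close>

definition cross :: "'v set \<Rightarrow> 'v set \<Rightarrow> 'v set set" where
  "cross A B = (\<lambda>(a, b). {a, b}) ` (A \<times> B)"

lemma mem_cross: "{a, b} \<in> cross A B \<longleftrightarrow> a \<in> A \<and> b \<in> B \<or> b \<in> A \<and> a \<in> B"
  by (force simp: cross_def doubleton_eq_iff)

lemma ex_enumeration:
  assumes "finite C" "card C = k" shows "\<exists>f. bij_betw f {..<k} C"
  using ex_bij_betw_nat_finite[OF assms(1)] assms(2) by (simp add: atLeast0LessThan)

lemma bij_betw_blocks:
  fixes f :: "nat \<Rightarrow> 'e"
  assumes "bij_betw f {..<k * h} C"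
  shows "bij_betw (\<lambda>(i, c). f (i * h + c)) ({..<k} \<times> {..<h}) C"
proof -
  have "bij_betw (\<lambda>(i, c). i * h + c) ({..<k} \<times> {..<h}) {..<k * h}"
  proof (rule bij_betwI[where g = "\<lambda>j. (j div h, j mod h)"])
    show "(\<lambda>(i, c). i * h + c) \<in> {..<k} \<times> {..<h} \<rightarrow> {..<k * h}"
      by (auto intro: block_index_less)
    show "(\<lambda>j. (j div h, j mod h)) \<in> {..<k * h} \<rightarrow> {..<k} \<times> {..<h}"
      by (auto simp: less_mult_imp_div_less intro!: mod_less_divisor gr0I)
  qed (auto simp: div_mult_mod_eq)
  from bij_betw_trans[OF this assms] show ?thesis
    by (simp add: comp_def case_prod_unfold)
qed

lemma ex_halves:
  assumes "finite C" "card C = 2 * h"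
  shows "\<exists>w :: bool \<Rightarrow> nat \<Rightarrow> 'e. bij_betw (\<lambda>(b, c). w b c) (UNIV \<times> {..<h}) C"
proof -
  obtain f where "bij_betw f {..<2 * h} C" using ex_enumeration[OF assms] by auto
  from bij_betw_blocks[OF this] have f: "bij_betw (\<lambda>(i, c). f (i * h + c)) ({..<2} \<times> {..<h}) C" .
  define w where "w b c = f ((if b then 1 else 0) * h + c)" for b c
  have w: "bij_betw (\<lambda>(b, c). w b c) (UNIV \<times> {..<h}) C"
  proof -
    have "bij_betw (\<lambda>(b, c). (if b then 1 else 0 :: nat, c)) (UNIV \<times> {..<h}) ({..<2} \<times> {..<h})"
      by (rule bij_betwI[where g = "\<lambda>(i, c). (i = 1, c)"]) (auto split: if_splits)
    from bij_betw_trans[OF this f] show ?thesis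
      by (simp add: comp_def case_prod_unfold w_def)
  qed
  from w show ?thesis by blast
qed

lemma magic_block_mono: "magic_block P \<S> \<Longrightarrow> \<T> \<subseteq> \<S> \<Longrightarrow> magic_block P \<T>"
  unfolding magic_block_def by (meson subsetD)

text \<open>The four vertices of \<open>G\<close> index the rows and two halves of \<open>C\<close>
  the sides. A vertex of \<open>G\<close> meets both edges of each opposite pair; a vertex of
  \<open>C\<close> meets exactly one edge in each row, always at the same side and column. The star
  at a vertex of \<open>G\<close> consists of the two sides of one row.\<close>

lemma magic_block_rows:
  assumes G: "card G = 4" and C: "finite C" "card C = 2 * h" and disj: "G \<inter> C = {}"
  shows "magic_block (cross G C) ((\<lambda>u. cross {u} C) ` G)"
proof -
  have finG: "finite G" using G by (simp add: card_ge_0_finite)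
  obtain g :: "nat \<Rightarrow> 'a" where g: "bij_betw g {..<4} G" using ex_enumeration[OF finG G] by auto
  obtain w :: "bool \<Rightarrow> nat \<Rightarrow> 'a" where w: "bij_betw (\<lambda>(b, c). w b c) (UNIV \<times> {..<h}) C"
    using ex_halves[OF C] by auto
  define e where "e i b c = {g i, w b c}" for i b c
  have gG: "g i \<in> G" if "i < 4" for i using g that by (auto simp: bij_betw_def)
  have wC: "w b c \<in> C" if "c < h" for b c using w that by (auto simp: bij_betw_def)
  have w_eq: "w b c = w b' c' \<longleftrightarrow> b = b' \<and> c = c'" if "c < h" "c' < h" for b c b' c'
    using bij_betw_imp_inj_on[OF w, THEN inj_onD, of "(b, c)" "(b', c')"] that by auto
  have g_eq: "g i = g i' \<longleftrightarrow> i = i'" if "i < 4" "i' < 4" for i i'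
    using bij_betw_imp_inj_on[OF g, THEN inj_onD, of i i'] that by auto
  have ne: "g i \<noteq> w b c" if "i < 4" "c < h" for i b c
    using gG wC disj that by (metis disjoint_iff)
  have inj: "inj_on (\<lambda>(i, b, c). e i b c) ({..<4} \<times> UNIV \<times> {..<h})"
    by (rule inj_onI, clarify) (use ne in \<open>auto simp: e_def doubleton_eq_iff g_eq w_eq\<close>)
  have star: "cross {u} C = (\<Union>(i, b)\<in>{i} \<times> UNIV. e i b ` {..<h})" if "u = g i" for u i
    unfolding cross_def e_def that bij_betw_imp_surj_on[OF w, symmetric]
    by (force simp: image_iff)
  have P: "cross G C = (\<lambda>(i, b, c). e i b c) ` ({..<4} \<times> UNIV \<times> {..<h})"
    unfolding cross_def e_def bij_betw_imp_surj_on[OF w, symmetric] bij_betw_imp_surj_on[OF g, symmetric]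
    by (force simp: image_iff)
  have "magic_block (cross G C)
      {S. \<exists>K \<subseteq> {..<4} \<times> UNIV. card K \<le> 4 \<and> S = (\<Union>(i, b)\<in>K. e i b ` {..<h})}"
  proof (rule magic_block_four[OF inj P])
    fix v
    show "(\<forall>i<4. \<forall>c<h. v \<in> e i True c \<longleftrightarrow> v \<in> e i False c) \<or>
        (\<forall>b. \<forall>c<h. \<forall>i<4. v \<in> e i b c \<longleftrightarrow> v \<in> e 0 b c)"
    proof (cases "v \<in> C")
      case True
      then have "v \<noteq> g i" if "i < 4" for i using gG[OF that] disj by auto
      then show ?thesis by (auto simp: e_def)
    next
      case False
      then have "v \<noteq> w b c" if "c < h" for b c using wC[OF that] by auto
      then show ?thesis by (auto simp: e_def)
    qed
  qed
  then show ?thesis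
  proof (rule magic_block_mono, clarify)
    fix u assume "u \<in> G"
    then obtain i where i: "i < 4" "u = g i" using g by (auto simp: bij_betw_def)
    show "\<exists>K \<subseteq> {..<4} \<times> UNIV. card K \<le> 4 \<and> cross {u} C = (\<Union>(i, b)\<in>K. e i b ` {..<h})"
      by (rule exI[of _ "{i} \<times> UNIV"]) (use i star[OF i(2)] in \<open>auto simp: card_cartesian_product\<close>)
  qed
qed

text \<open>The roles are exchanged: the two vertices of \<open>X\<close> are the sides, and four
  quarters of \<open>C\<close> are the rows. The star at a vertex of \<open>X\<close> is therefore
  one side of all four rows.\<close>

lemma magic_block_pair:
  assumes X: "card X = 2" and C: "finite C" "card C = 4 * h" and disj: "X \<inter> C = {}"
  shows "magic_block (cross X C) ((\<lambda>u. cross {u} C) ` X)"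
proof -
  obtain x0 x1 where x: "X = {x0, x1}" "x0 \<noteq> x1" using X by (auto simp: card_2_iff)
  define g where "g b = (if b then x1 else x0)" for b
  obtain f where "bij_betw f {..<4 * h} C" using ex_enumeration[OF C] by auto
  from bij_betw_blocks[OF this] have w: "bij_betw (\<lambda>(i, c). f (i * h + c)) ({..<4} \<times> {..<h}) C" .
  define e where "e i b c = {g b, f (i * h + c)}" for i b c
  have gX: "g b \<in> X" for b by (auto simp: g_def x)
  have g_eq: "g b = g b' \<longleftrightarrow> b = b'" for b b' using x(2) by (auto simp: g_def)
  have rX: "X = range g" unfolding x g_def by (auto simp: image_iff)
  have wC: "f (i * h + c) \<in> C" if "i < 4" "c < h" for i c
    using w that by (auto simp: bij_betw_def)
  have w_eq: "f (i * h + c) = f (i' * h + c') \<longleftrightarrow> i = i' \<and> c = c'"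
    if "i < 4" "i' < 4" "c < h" "c' < h" for i i' c c'
    using bij_betw_imp_inj_on[OF w, THEN inj_onD, of "(i, c)" "(i', c')"] that by auto
  have ne: "g b \<noteq> f (i * h + c)" if "i < 4" "c < h" for i b c
    using gX wC disj that by (metis disjoint_iff)
  have inj: "inj_on (\<lambda>(i, b, c). e i b c) ({..<4} \<times> UNIV \<times> {..<h})"
    by (rule inj_onI, clarify) (use ne in \<open>auto simp: e_def doubleton_eq_iff g_eq w_eq\<close>)
  have star: "cross {u} C = (\<Union>(i, b)\<in>{..<4} \<times> {b}. e i b ` {..<h})" if "u = g b" for u b
    unfolding cross_def e_def that bij_betw_imp_surj_on[OF w, symmetric]
    by (force simp: image_iff)
  have P: "cross X C = (\<lambda>(i, b, c). e i b c) ` ({..<4} \<times> UNIV \<times> {..<h})"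
    unfolding cross_def e_def bij_betw_imp_surj_on[OF w, symmetric] rX
    by (force simp: image_iff)
  have "magic_block (cross X C)
      {S. \<exists>K \<subseteq> {..<4} \<times> UNIV. card K \<le> 4 \<and> S = (\<Union>(i, b)\<in>K. e i b ` {..<h})}"
  proof (rule magic_block_four[OF inj P])
    fix v
    show "(\<forall>i<4. \<forall>c<h. v \<in> e i True c \<longleftrightarrow> v \<in> e i False c) \<or>
        (\<forall>b. \<forall>c<h. \<forall>i<4. v \<in> e i b c \<longleftrightarrow> v \<in> e 0 b c)"
    proof (cases "v \<in> C")
      case True
      then have "v \<noteq> g b" for b using gX disj by auto
      then show ?thesis by (auto simp: e_def)
    next
      case False
      then have "v \<noteq> f (i * h + c)" if "i < 4" "c < h" for i c using wC[OF that] by auto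
      then have "v \<in> e i b c \<longleftrightarrow> v = g b" if "i < 4" "c < h" for i b c
        using that by (auto simp: e_def)
      then show ?thesis by simp
    qed
  qed
  then show ?thesis
  proof (rule magic_block_mono, clarify)
    fix u assume "u \<in> X"
    then obtain b where b: "u = g b" using rX by auto
    show "\<exists>K \<subseteq> {..<4} \<times> UNIV. card K \<le> 4 \<and> cross {u} C = (\<Union>(i, b)\<in>K. e i b ` {..<h})"
      by (rule exI[of _ "{..<4} \<times> {b}"]) (use star[OF b] in \<open>auto simp: card_cartesian_product\<close>)
  qed
qed


section \<open>Stars\<close>

lemma cross_Un: "cross (A \<union> B) C = cross A C \<union> cross B C"
  by (auto simp: cross_def)

lemma cross_empty [simp]: "cross {} C = {}"
  by (simp add: cross_def)

lemma finite_cross: "finite A \<Longrightarrow> finite B \<Longrightarrow> finite (cross A B)"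
  by (simp add: cross_def)

lemma mem_crossD: "e \<in> cross A B \<Longrightarrow> \<exists>a\<in>A. \<exists>b\<in>B. e = {a, b}"
  by (auto simp: cross_def)

lemma card_star: "card (cross {x} C) = card C" if "x \<notin> C"
proof -
  have "cross {x} C = (\<lambda>c. {x, c}) ` C" by (auto simp: cross_def)
  moreover have "inj_on (\<lambda>c. {x, c}) C" by (auto simp: inj_on_def doubleton_eq_iff)
  ultimately show ?thesis by (simp add: card_image)
qed

text \<open>Half of the star gets positive values and the other half their negatives. The sum
  vanishes only at the centre: each leaf keeps the value of its single edge, which is why this is
  not stated as a \<open>magic_block\<close>.\<close>

lemma star_extend:
  assumes y: "centred E y" and C: "finite C" "card C = 2 * h" and x: "x \<notin> C"
    and disj: "E \<inter> cross {x} C = {}"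
  obtains y' where "centred (E \<union> cross {x} C) y'" "\<And>e. e \<in> E \<Longrightarrow> y' e = y e"
    "(\<Sum>e\<in>cross {x} C. y' e) = 0" "segmented y' (cross {x} C)"
proof -
  obtain w :: "bool \<Rightarrow> nat \<Rightarrow> 'a" where w: "bij_betw (\<lambda>(b, c). w b c) (UNIV \<times> {..<h}) C"
    using ex_halves[OF C] by auto
  define e where "e j b = {x, w b j}" for j b
  have wC: "w b c \<in> C" if "c < h" for b c using w that by (auto simp: bij_betw_def)
  have ne: "x \<noteq> w b c" "w b c \<noteq> x" if "c < h" for b c using wC[OF that] x by auto
  have w_eq: "w b c = w b' c' \<longleftrightarrow> b = b' \<and> c = c'" if "c < h" "c' < h" for b c b' c'
    using bij_betw_imp_inj_on[OF w, THEN inj_onD, of "(b, c)" "(b', c')"] that by auto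
  have inj: "inj_on (\<lambda>(j, b). e j b) ({..<h} \<times> UNIV)"
    by (rule inj_onI, clarify) (use ne in \<open>auto simp: e_def doubleton_eq_iff w_eq\<close>)
  have P: "cross {x} C = (\<lambda>(j, b). e j b) ` ({..<h} \<times> UNIV)"
    unfolding cross_def e_def bij_betw_imp_surj_on[OF w, symmetric] by (force simp: image_iff)
  obtain y' where y': "centred (E \<union> cross {x} C) y'" "\<And>e. e \<in> E \<Longrightarrow> y' e = y e"
    "\<And>j b. j < h \<Longrightarrow> y' (e j b) = (if b then 1 else -1) * (int (card E) + 1 + 2 * int j)"
    using centred_extend[OF y inj P disj] by blast
  have "(\<Sum>e\<in>cross {x} C. y' e) = (\<Sum>j<h. \<Sum>b\<in>UNIV. y' (e j b))"
    unfolding P by (subst sum.reindex[OF inj]) (simp add: sum.cartesian_product case_prod_unfold)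
  also have "\<dots> = 0" by (rule sum.neutral) (auto simp: UNIV_bool y'(3))
  finally have sum0: "(\<Sum>e\<in>cross {x} C. y' e) = 0" .
  define \<F> where "\<F> = range (\<lambda>b. (\<lambda>j. e j b) ` {..<h})"
  have "finite \<F>" "card \<F> \<le> 4"
    using card_image_le[of UNIV "\<lambda>b::bool. (\<lambda>j. e j b) ` {..<h}"] by (auto simp: \<F>_def)
  moreover have "disjoint \<F>"
  proof (rule disjointI)
    fix F F' assume "F \<in> \<F>" "F' \<in> \<F>" and neq: "F \<noteq> F'"
    then obtain b b' where *: "F = (\<lambda>j. e j b) ` {..<h}" "F' = (\<lambda>j. e j b') ` {..<h}"
      unfolding \<F>_def by auto
    have False if "c < h" "c' < h" "e c b = e c' b'" for c c'
      using inj_onD[OF inj, of "(c, b)" "(c', b')"] that * neq by auto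
    then show "F \<inter> F' = {}" using * by auto
  qed
  moreover have "\<Union>\<F> = cross {x} C" unfolding P \<F>_def by auto
  moreover have "run y' F" if "F \<in> \<F>" for F
  proof -
    from that obtain b where "F = (\<lambda>j. e j b) ` {..<h}" unfolding \<F>_def by (rule rangeE)
    then show ?thesis using runI[of h y' "\<lambda>j. e j b", OF y'(3)] by simp
  qed
  ultimately have "segmented y' (cross {x} C)" unfolding segmented_def by blast
  with y' sum0 show ?thesis using that by blast
qed

section \<open>Decomposition of the complete graph\<close>

definition cls :: "nat \<Rightarrow> nat" where
  "cls v = (v - 1) div 4"

definition quad :: "nat \<Rightarrow> nat \<Rightarrow> nat set" where
  "quad n i = {v \<in> {1..n}. cls v = i}"

text \<open>\<open>q\<close> is the index of the incomplete last class, which beats all others.\<close>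

definition beats :: "nat \<Rightarrow> nat \<Rightarrow> nat \<Rightarrow> bool" where
  "beats q i j \<longleftrightarrow> i \<noteq> j \<and> j \<noteq> q \<and> (i = q \<or> (if i < j then odd (i + j) else even (i + j)))"

definition beaten :: "nat \<Rightarrow> nat \<Rightarrow> nat set" where
  "beaten n i = {w \<in> {1..n}. beats (n div 4) i (cls w)}"

definition inner :: "nat \<Rightarrow> nat set set" where
  "inner n = {e \<in> complete_edges n. \<forall>u\<in>e. \<forall>v\<in>e. cls u = cls v}"

lemma complete_edge_cases:
  assumes "e \<in> complete_edges n"
  obtains a b where "e = {a, b}" "a \<noteq> b" "a \<in> {1..n}" "b \<in> {1..n}"
  using assms unfolding complete_edges_def by (auto simp: card_2_iff)

lemma mem_complete_edges: "{a, b} \<in> complete_edges n \<longleftrightarrow> a \<noteq> b \<and> a \<in> {1..n} \<and> b \<in> {1..n}"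
  by (auto simp: complete_edges_def card_insert_if)

lemma finite_complete_edges: "finite (complete_edges n)"
  by (rule finite_subset[of _ "Pow {1..n}"]) (auto simp: complete_edges_def)

text \<open>The parity of \<open>i + j\<close> is symmetric while the order of \<open>i\<close> and
  \<open>j\<close> is not, so exactly one of two distinct classes below \<open>q\<close> wins; class
  \<open>q\<close> wins by decree.\<close>

lemma beats_antisym: "i \<noteq> j \<Longrightarrow> i \<le> q \<Longrightarrow> j \<le> q \<Longrightarrow> beats q i j \<longleftrightarrow> \<not> beats q j i"
  by (auto simp: beats_def add.commute)

lemma cls_le: "v \<in> {1..n} \<Longrightarrow> cls v \<le> n div 4"
  unfolding cls_def by (intro div_le_mono) auto

lemma quad_less: "i < n div 4 \<Longrightarrow> quad n i = {4 * i + 1..4 * i + 4}"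
  unfolding quad_def cls_def by auto

lemma card_quad: "i < n div 4 \<Longrightarrow> card (quad n i) = 4"
  by (simp add: quad_less)

lemma quad_last: "quad n (n div 4) = {4 * (n div 4) + 1..n}"
  unfolding quad_def cls_def by auto

lemma card_quad_le: "card (quad n i) \<le> 4"
proof -
  have "quad n i \<subseteq> {4 * i + 1..4 * i + 4}" unfolding quad_def cls_def by auto
  from card_mono[OF _ this] show ?thesis by simp
qed

text \<open>The last class \<open>n div 4\<close> is beaten by nobody, so a beaten set is a union of
  full quadruples. In particular its size is even, as \<open>magic_block_rows\<close>
  demands.\<close>

lemma card_beaten: "card (beaten n i) = 4 * card {j. j < n div 4 \<and> beats (n div 4) i j}"
proof -
  let ?J = "{j. j < n div 4 \<and> beats (n div 4) i j}"
  have "beaten n i = (\<Union>j\<in>?J. quad n j)"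
    using cls_le[of _ n] unfolding beaten_def quad_def by (fastforce simp: beats_def)
  also have "card \<dots> = (\<Sum>j\<in>?J. card (quad n j))"
    by (rule card_UN_disjoint) (auto simp: quad_def)
  also have "\<dots> = 4 * card ?J" by (simp add: card_quad)
  finally show ?thesis .
qed

lemma card_beats_ge:
  assumes "i < q"
  shows "q \<le> 2 * card {j. j < q \<and> beats q i j} + 2"
proof -
  \<comment> \<open>Class \<open>i\<close> beats the smaller classes of its own parity,
    \<open>i - 2\<close>, \<open>i - 4\<close>, ..., and the larger ones of the other parity,
    \<open>i + 1\<close>, \<open>i + 3\<close>, .... The two roundings down together lose at most
    one win against \<open>q / 2\<close>.\<close>
  let ?A = "(\<lambda>k. i - 2 - 2 * k) ` {..<i div 2}" and ?B = "(\<lambda>k. i + 1 + 2 * k) ` {..<(q - i) div 2}"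
  have sub: "?A \<union> ?B \<subseteq> {j. j < q \<and> beats q i j}"
    using assms by (auto simp: beats_def)
  have "card ?A = i div 2" by (subst card_image) (auto simp: inj_on_def)
  moreover have "card ?B = (q - i) div 2" by (subst card_image) (auto simp: inj_on_def)
  moreover have "?A \<inter> ?B = {}" by auto
  ultimately have "i div 2 + (q - i) div 2 = card (?A \<union> ?B)"
    by (subst card_Un_disjoint) auto
  also have "\<dots> \<le> card {j. j < q \<and> beats q i j}" using sub by (intro card_mono) auto
  finally show ?thesis using assms by linarith
qed

lemma complete_edges_decomp:
  "complete_edges n = inner n \<union> (\<Union>i\<le>n div 4. cross (quad n i) (beaten n i))"
proof (intro set_eqI iffI)
  fix e assume e: "e \<in> complete_edges n"
  then obtain a b where ab: "e = {a, b}" "a \<noteq> b" "a \<in> {1..n}" "b \<in> {1..n}"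
    by (rule complete_edge_cases)
  show "e \<in> inner n \<union> (\<Union>i\<le>n div 4. cross (quad n i) (beaten n i))"
  proof (cases "cls a = cls b")
    case True
    then have "e \<in> inner n" using e ab by (auto simp: inner_def)
    then show ?thesis ..
  next
    case False
    have "beats (n div 4) (cls a) (cls b) \<or> beats (n div 4) (cls b) (cls a)"
      using beats_antisym[OF False] cls_le ab by blast
    then have "{a, b} \<in> cross (quad n (cls a)) (beaten n (cls a)) \<or>
        {a, b} \<in> cross (quad n (cls b)) (beaten n (cls b))"
      using ab by (auto simp: mem_cross quad_def beaten_def)
    then show ?thesis using ab cls_le[of a n] cls_le[of b n] by auto
  qed
next
  fix e assume "e \<in> inner n \<union> (\<Union>i\<le>n div 4. cross (quad n i) (beaten n i))"
  then show "e \<in> complete_edges n"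
  proof
    assume "e \<in> (\<Union>i\<le>n div 4. cross (quad n i) (beaten n i))"
    then obtain i a b where "e = {a, b}" "a \<in> quad n i" "b \<in> beaten n i"
      by (auto dest: mem_crossD)
    then show ?thesis by (auto simp: mem_complete_edges quad_def beaten_def beats_def)
  qed (auto simp: inner_def)
qed

lemma inner_disjoint: "inner n \<inter> cross (quad n i) (beaten n i) = {}"
  by (auto dest!: mem_crossD simp: inner_def quad_def beaten_def beats_def)

lemma cross_quad_disjoint:
  assumes "i \<noteq> j" "i \<le> n div 4" "j \<le> n div 4"
  shows "cross (quad n i) (beaten n i) \<inter> cross (quad n j) (beaten n j) = {}"
proof (rule ccontr)
  assume "\<not> ?thesis"
  then obtain e where "e \<in> cross (quad n i) (beaten n i)" "e \<in> cross (quad n j) (beaten n j)"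
    by auto
  moreover from this(1) obtain a b where "a \<in> quad n i" "b \<in> beaten n i" "e = {a, b}"
    by (auto dest: mem_crossD)
  ultimately show False
    using assms beats_antisym[of i j "n div 4"] by (auto simp: mem_cross quad_def beaten_def)
qed

lemma incident_complete: "v \<in> {1..n} \<Longrightarrow> incident_edges (complete_edges n) v = cross {v} ({1..n} - {v})"
proof (intro set_eqI iffI)
  fix e assume v: "v \<in> {1..n}" and "e \<in> incident_edges (complete_edges n) v"
  then have e: "e \<in> complete_edges n" "v \<in> e" by (auto simp: incident_edges_def)
  then obtain a b where "e = {a, b}" "a \<noteq> b" "a \<in> {1..n}" "b \<in> {1..n}"
    by (auto elim: complete_edge_cases)
  then show "e \<in> cross {v} ({1..n} - {v})" using e(2) by (auto simp: mem_cross)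
next
  fix e assume v: "v \<in> {1..n}" and e: "e \<in> cross {v} ({1..n} - {v})"
  from mem_crossD[OF e] obtain a b where "a \<in> {v}" "b \<in> {1..n} - {v}" "e = {a, b}" by blast
  then have "e = {v, b}" "b \<noteq> v" "b \<in> {1..n}" by simp_all
  then show "e \<in> incident_edges (complete_edges n) v"
    using v by (auto simp: incident_edges_def mem_complete_edges)
qed

lemma card_incident_complete: "v \<in> {1..n} \<Longrightarrow> card (incident_edges (complete_edges n) v) = n - 1"
  by (simp add: incident_complete card_star)

lemma card_incident_inner: "v \<in> {1..n} \<Longrightarrow> card (incident_edges (inner n) v) \<le> 3"
proof -
  assume v: "v \<in> {1..n}"
  have "incident_edges (inner n) v \<subseteq> cross {v} (quad n (cls v) - {v})"
  proof
    fix e assume "e \<in> incident_edges (inner n) v"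
    then have e: "e \<in> complete_edges n" "v \<in> e" and same: "\<And>u. u \<in> e \<Longrightarrow> cls u = cls v"
      unfolding incident_edges_def inner_def by blast+
    obtain a b where ab: "e = {a, b}" "a \<noteq> b" "a \<in> {1..n}" "b \<in> {1..n}"
      using e(1) by (rule complete_edge_cases)
    have "cls a = cls v" "cls b = cls v" using same ab(1) by blast+
    then show "e \<in> cross {v} (quad n (cls v) - {v})"
      using e(2) ab by (auto simp: mem_cross quad_def)
  qed
  moreover have fin: "finite (quad n (cls v))" by (auto simp: quad_def)
  ultimately have "card (incident_edges (inner n) v) \<le> card (cross {v} (quad n (cls v) - {v}))"
    by (intro card_mono) (auto intro: finite_cross)
  also have "\<dots> = card (quad n (cls v) - {v})" by (rule card_star) simp
  also have "\<dots> \<le> 3" using v card_quad_le[of n "cls v"] fin by (simp add: quad_def)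
  finally show ?thesis .
qed

text \<open>Double counting of incidences: every edge has two ends and every vertex lies on at most
  three inner edges.\<close>

lemma card_inner_le: "2 * card (inner n) \<le> 3 * n"
proof -
  have fin: "finite (inner n)"
    using finite_complete_edges by (rule finite_subset[rotated]) (auto simp: inner_def)
  have "{v \<in> {1..n}. v \<in> e} = e \<and> card e = 2" if "e \<in> inner n" for e
    using that by (auto simp: inner_def complete_edges_def)
  then have "(\<Sum>v\<in>{1..n}. card {e \<in> inner n. v \<in> e}) = (\<Sum>e\<in>inner n. 2)"
    by (intro sum_multicount_gen fin) auto
  then have "2 * card (inner n) = (\<Sum>v\<in>{1..n}. card (incident_edges (inner n) v))"
    by (simp add: incident_edges_def)
  also have "\<dots> \<le> (\<Sum>v\<in>{1..n}. 3)" by (intro sum_mono card_incident_inner)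
  finally show ?thesis by simp
qed


text \<open>For odd \<open>n\<close> the last class has one or three vertices. Removing
  \<open>n\<close> leaves none or two there, so that \<open>magic_block_pair\<close> applies to the
  rest.\<close>

definition odd_last :: "nat \<Rightarrow> nat set" where
  "odd_last n = (if even n then {} else {n})"

lemma beaten_last: "beaten n (n div 4) = {1..4 * (n div 4)}"
  unfolding beaten_def beats_def cls_def by auto

lemma incident_Un: "incident_edges (E \<union> P) v = incident_edges E v \<union> incident_edges P v"
  by (auto simp: incident_edges_def)

text \<open>With \<open>N \<le> 3 n / 2\<close> inner edges, at most three at each vertex, and one edge of the star, the bound is
  \<open>3 N + (N + 4 (n div 4)) \<le> 7 n\<close>.\<close>

lemma ex_core_labelling:
  defines "A \<equiv> \<lambda>n. beaten n (n div 4)"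
  obtains y where "centred (inner n \<union> cross (odd_last n) (A n)) y"
    "\<And>v. v \<in> {1..n} \<Longrightarrow>
      \<bar>\<Sum>e\<in>incident_edges (inner n \<union> cross (odd_last n) (A n)) v. y e\<bar> \<le> 7 * int n"
    "\<And>u. u \<in> odd_last n \<Longrightarrow> segmented y (cross {u} (A n))"
proof -
  define N where "N = int (card (inner n))"
  have fin: "finite (inner n)"
    using finite_complete_edges by (rule finite_subset[rotated]) (auto simp: inner_def)
  have N: "2 * N \<le> 3 * int n" using card_inner_le[of n] by (simp add: N_def)
  obtain y0 where y0: "centred (inner n) y0" using ex_centred[OF fin] by auto
  have in0: "\<bar>\<Sum>e\<in>incident_edges (inner n) v. y0 e\<bar> \<le> 3 * N" if v: "v \<in> {1..n}" for v
  proof -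
    have "\<bar>y0 e\<bar> \<le> N" if "e \<in> incident_edges (inner n) v" for e
      using y0 that unfolding centred_def incident_edges_def N_def
      by (auto dest!: bij_betwE simp: less_imp_le)
    then have "\<bar>\<Sum>e\<in>incident_edges (inner n) v. y0 e\<bar> \<le> (\<Sum>e\<in>incident_edges (inner n) v. N)"
      by (intro order.trans[OF sum_abs] sum_mono)
    also have "\<dots> = int (card (incident_edges (inner n) v)) * N" by simp
    also have "\<dots> \<le> 3 * N"
      using card_incident_inner[OF v] by (intro mult_right_mono) (auto simp: N_def)
    finally show ?thesis .
  qed
  show ?thesis
  proof (cases "even n")
    case True
    have "\<bar>\<Sum>e\<in>incident_edges (inner n) v. y0 e\<bar> \<le> 7 * int n" if "v \<in> {1..n}" for v
      using in0[OF that] N by linarith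
    then show ?thesis using that[of y0] y0 True by (simp add: odd_last_def)
  next
    case False
    then have A: "A n = {1..4 * (n div 4)}" "finite (A n)" "card (A n) = 2 * (2 * (n div 4))"
      unfolding A_def beaten_last by simp_all
    have nA: "n \<notin> A n" using False unfolding A(1) by (metis atLeastAtMost_iff dvd_triv_left
      dvd_mult_div_cancel even_numeral even_mult_iff le_antisym div_times_less_eq_dividend mult.commute)
    have star: "cross (odd_last n) (A n) = cross {n} (A n)" using False by (simp add: odd_last_def)
    have "n \<in> quad n (n div 4)" using False nA unfolding A(1) quad_last by (auto intro: Suc_leI)
    then have "cross {n} (A n) \<subseteq> cross (quad n (n div 4)) (A n)" by (auto simp: cross_def)
    then have disj: "inner n \<inter> cross {n} (A n) = {}"
      using inner_disjoint[of n "n div 4"] unfolding A_def by blast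
    obtain y where y: "centred (inner n \<union> cross {n} (A n)) y" "\<And>e. e \<in> inner n \<Longrightarrow> y e = y0 e"
      "(\<Sum>e\<in>cross {n} (A n). y e) = 0" "segmented y (cross {n} (A n))"
      using star_extend[OF y0 A(2,3) nA disj] by blast
    have fin': "finite (cross {n} (A n))" using A(2) by (simp add: finite_cross)
    have card: "int (card (inner n \<union> cross {n} (A n))) = N + 4 * int (n div 4)"
      using card_Un_disjoint[OF fin fin' disj] nA A(3) by (simp add: card_star N_def)
    have "\<bar>\<Sum>e\<in>incident_edges (inner n \<union> cross {n} (A n)) v. y e\<bar> \<le> 7 * int n"
      if v: "v \<in> {1..n}" for v
    proof -
      have "(\<Sum>e\<in>incident_edges (inner n \<union> cross {n} (A n)) v. y e)
          = (\<Sum>e\<in>incident_edges (inner n) v. y e) + (\<Sum>e\<in>incident_edges (cross {n} (A n)) v. y e)"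
        unfolding incident_Un using fin fin' disj
        by (intro sum.union_disjoint) (auto simp: incident_edges_def)
      also have "(\<Sum>e\<in>incident_edges (inner n) v. y e) = (\<Sum>e\<in>incident_edges (inner n) v. y0 e)"
        by (rule sum.cong) (auto simp: incident_edges_def y(2))
      finally have split: "(\<Sum>e\<in>incident_edges (inner n \<union> cross {n} (A n)) v. y e)
          = (\<Sum>e\<in>incident_edges (inner n) v. y0 e) + (\<Sum>e\<in>incident_edges (cross {n} (A n)) v. y e)" .
      have "\<bar>\<Sum>e\<in>incident_edges (cross {n} (A n)) v. y e\<bar> \<le> N + 4 * int (n div 4)"
      proof -
        \<comment> \<open>The star contributes 0 at its centre, one edge at a leaf, whose value is
          below the total number \<open>N + 4 * (n div 4)\<close> of edges labeled so far, and
          nothing elsewhere.\<close>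
        consider "v = n" | "v \<in> A n" "v \<noteq> n" | "v \<notin> A n" "v \<noteq> n" by blast
        then show ?thesis
        proof cases
          case 1
          then have "incident_edges (cross {n} (A n)) v = cross {n} (A n)"
            by (auto simp: incident_edges_def dest: mem_crossD)
          then show ?thesis using y(3) by (simp add: N_def)
        next
          case 2
          then have "incident_edges (cross {n} (A n)) v = {{n, v}}"
            by (auto simp: incident_edges_def mem_cross dest: mem_crossD)
          moreover have "{n, v} \<in> inner n \<union> cross {n} (A n)" using 2 by (simp add: mem_cross)
          then have "\<bar>y {n, v}\<bar> < N + 4 * int (n div 4)"
            using y(1) unfolding centred_def card by (auto dest!: bij_betwE)
          ultimately show ?thesis by simp
        next
          case 3
          then have "incident_edges (cross {n} (A n)) v = {}"
            by (auto simp: incident_edges_def dest!: mem_crossD)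
          then show ?thesis by (simp add: N_def)
        qed
      qed
      moreover have "4 * int (n div 4) \<le> int n" by linarith
      ultimately show ?thesis using split in0[OF v] N by linarith
    qed
    then show ?thesis using that[of y] y star False by (simp add: odd_last_def)
  qed
qed

text \<open>All edges outside the core split into one block for each full quadruple and, if two
  vertices remain, one block for that pair, whose beaten set has \<open>4 * (n div 4)\<close>
  elements and so divides into quarters. The tournament makes these blocks disjoint.\<close>

lemma outer_magic_block:
  defines "X \<equiv> \<lambda>n. quad n (n div 4) - odd_last n"
  shows "magic_block (cross (X n) (beaten n (n div 4)) \<union> (\<Union>i<n div 4. cross (quad n i) (beaten n i)))
    ((\<lambda>u. cross {u} (beaten n (n div 4))) ` X n \<union>
     (\<Union>i<n div 4. (\<lambda>u. cross {u} (beaten n i)) ` quad n i))"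
proof (rule magic_block_Un)
  let ?q = "n div 4"
  have fin: "finite (beaten n i)" for i by (simp add: beaten_def)
  have disj: "quad n i \<inter> beaten n i = {}" for i by (auto simp: quad_def beaten_def beats_def)
  show "magic_block (cross (X n) (beaten n ?q)) ((\<lambda>u. cross {u} (beaten n ?q)) ` X n)"
  proof -
    have "n = 4 * ?q + n mod 4" by simp
    moreover have "n mod 4 = 0 \<or> n mod 4 = 1 \<or> n mod 4 = 2 \<or> n mod 4 = 3" by linarith
    ultimately consider "n = 4 * ?q" | "n = 4 * ?q + 1" | "n = 4 * ?q + 2" | "n = 4 * ?q + 3"
      by linarith
    then have "X n = {} \<or> X n = {4 * ?q + 1, 4 * ?q + 2}"
    proof cases
      case 1
      then show ?thesis unfolding X_def quad_last by auto
    next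
      case 2
      then have "odd n" by presburger
      moreover have "quad n ?q = {n}" using 2 unfolding quad_last by auto
      ultimately show ?thesis by (simp add: X_def odd_last_def)
    next
      case 3
      then have "even n" by presburger
      moreover have "quad n ?q = {4 * ?q + 1, 4 * ?q + 2}" using 3 unfolding quad_last by auto
      ultimately show ?thesis by (simp add: X_def odd_last_def)
    next
      case 4
      then have "odd n" by presburger
      moreover have "quad n ?q - {n} = {4 * ?q + 1, 4 * ?q + 2}" using 4 unfolding quad_last by auto
      ultimately show ?thesis by (simp add: X_def odd_last_def)
    qed
    then show ?thesis
    proof
      assume "X n = {}"
      then show ?thesis by (simp add: magic_block_empty)
    next
      assume "X n = {4 * ?q + 1, 4 * ?q + 2}"
      then have "card (X n) = 2" by simp
      moreover have "card (beaten n ?q) = 4 * ?q" by (simp add: beaten_last)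
      moreover have "X n \<inter> beaten n ?q = {}" using disj[of ?q] by (auto simp: X_def)
      ultimately show ?thesis by (intro magic_block_pair fin)
    qed
  qed
  show "magic_block (\<Union>i<?q. cross (quad n i) (beaten n i))
      (\<Union>i<?q. (\<lambda>u. cross {u} (beaten n i)) ` quad n i)"
  proof (rule magic_block_UN)
    fix i assume "i \<in> {..<?q}"
    then have "card (quad n i) = 4" by (simp add: card_quad)
    moreover have "card (beaten n i) = 2 * (2 * card {j. j < ?q \<and> beats ?q i j})"
      using card_beaten[of n i] by simp
    ultimately show "magic_block (cross (quad n i) (beaten n i))
        ((\<lambda>u. cross {u} (beaten n i)) ` quad n i)"
      by (intro magic_block_rows fin disj)
  next
    show "disjoint_family_on (\<lambda>i. cross (quad n i) (beaten n i)) {..<?q}"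
      unfolding disjoint_family_on_def using cross_quad_disjoint[of _ _ n] by auto
  qed simp
  have "cross (X n) (beaten n ?q) \<subseteq> cross (quad n ?q) (beaten n ?q)"
    by (auto simp: X_def cross_def)
  moreover have "cross (quad n ?q) (beaten n ?q) \<inter> cross (quad n i) (beaten n i) = {}" if "i < ?q" for i
    using cross_quad_disjoint[of ?q i n] that by simp
  ultimately show "cross (X n) (beaten n ?q) \<inter> (\<Union>i<?q. cross (quad n i) (beaten n i)) = {}"
    by fast
qed

text \<open>The core takes the values nearest to 0 and the outer block is placed around it. The
  outer block adds nothing to any vertex sum, so the bound \<open>7 * n\<close> is inherited from
  the core. For \<open>S\<close> one takes the star from \<open>v\<close> to everything its class
  beats.\<close>

lemma ex_robust_labelling:
  obtains y where "centred (complete_edges n) y"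
    "\<And>v. v \<in> {1..n} \<Longrightarrow> \<bar>\<Sum>e\<in>incident_edges (complete_edges n) v. y e\<bar> \<le> 7 * int n"
    "\<And>v. v \<in> {1..n} \<Longrightarrow> \<exists>S \<subseteq> incident_edges (complete_edges n) v. segmented y S \<and>
       2 * card (incident_edges (complete_edges n) v - S) \<le> n + 12"
proof -
  let ?q = "n div 4"
  define L where "L = odd_last n"
  define B where "B = inner n \<union> cross L (beaten n ?q)"
  define P where "P = cross (quad n ?q - L) (beaten n ?q) \<union> (\<Union>i<?q. cross (quad n i) (beaten n i))"
  define \<S> where "\<S> = (\<lambda>u. cross {u} (beaten n ?q)) ` (quad n ?q - L) \<union>
     (\<Union>i<?q. (\<lambda>u. cross {u} (beaten n i)) ` quad n i)"
  have L: "L \<subseteq> quad n ?q"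
  proof -
    have "n \<in> quad n ?q" if "odd n"
    proof -
      have "n \<noteq> 4 * ?q" using that by (metis even_mult_iff even_numeral)
      then show ?thesis unfolding quad_last by auto
    qed
    then show ?thesis by (auto simp: L_def odd_last_def)
  qed
  obtain y0 where y0: "centred B y0"
    "\<And>v. v \<in> {1..n} \<Longrightarrow> \<bar>\<Sum>e\<in>incident_edges B v. y0 e\<bar> \<le> 7 * int n"
    "\<And>u. u \<in> L \<Longrightarrow> segmented y0 (cross {u} (beaten n ?q))"
    using ex_core_labelling[of n] unfolding B_def L_def by blast
  have block: "magic_block P \<S>"
    using outer_magic_block[of n] unfolding P_def \<S>_def L_def .
  have "cross (quad n ?q) (beaten n ?q) = cross L (beaten n ?q) \<union> cross (quad n ?q - L) (beaten n ?q)"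
    using L by (auto simp: cross_Un[symmetric] Un_absorb1)
  moreover have "{..?q} = insert ?q {..<?q}" by auto
  ultimately have E: "complete_edges n = B \<union> P"
    unfolding complete_edges_decomp B_def P_def by auto
  have disj: "B \<inter> P = {}"
  proof -
    have "cross L (beaten n ?q) \<inter> cross (quad n ?q - L) (beaten n ?q) = {}"
    proof (rule ccontr)
      assume "\<not> ?thesis"
      then obtain e where e: "e \<in> cross L (beaten n ?q)" "e \<in> cross (quad n ?q - L) (beaten n ?q)"
        by auto
      from mem_crossD[OF e(1)] obtain a b where ab: "a \<in> L" "b \<in> beaten n ?q" "e = {a, b}" by auto
      have "quad n ?q \<inter> beaten n ?q = {}" by (auto simp: quad_def beaten_def beats_def)
      then show False using e(2) ab L by (auto simp: mem_cross)
    qed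
    moreover have "cross L (beaten n ?q) \<subseteq> cross (quad n ?q) (beaten n ?q)"
      "cross (quad n ?q - L) (beaten n ?q) \<subseteq> cross (quad n ?q) (beaten n ?q)"
      using L by (auto simp: cross_def)
    moreover have "cross (quad n ?q) (beaten n ?q) \<inter> cross (quad n i) (beaten n i) = {}" if "i < ?q" for i
      using cross_quad_disjoint[of ?q i n] that by simp
    ultimately show ?thesis
      unfolding B_def P_def using inner_disjoint[of n] by fast
  qed
  obtain y where y: "centred (B \<union> P) y" "\<forall>e\<in>B. y e = y0 e"
    "\<forall>v. (\<Sum>e | e \<in> P \<and> v \<in> e. y e) = 0" "\<forall>S\<in>\<S>. segmented y S"
    by (rule magic_blockE[OF block y0(1) disj])
  have fin: "finite B" "finite P" using y(1) by (auto simp: centred_def)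
  show ?thesis
  proof (rule that)
    show "centred (complete_edges n) y" using y(1) E by simp
    fix v assume v: "v \<in> {1..n}"
    have "(\<Sum>e\<in>incident_edges (complete_edges n) v. y e)
        = (\<Sum>e\<in>incident_edges B v. y e) + (\<Sum>e\<in>incident_edges P v. y e)"
      unfolding E incident_Un using fin disj
      by (intro sum.union_disjoint) (auto simp: incident_edges_def)
    also have "(\<Sum>e\<in>incident_edges B v. y e) = (\<Sum>e\<in>incident_edges B v. y0 e)"
      by (rule sum.cong) (use y(2) in \<open>auto simp: incident_edges_def\<close>)
    also have "(\<Sum>e\<in>incident_edges P v. y e) = 0" using y(3) by (simp add: incident_edges_def)
    finally show "\<bar>\<Sum>e\<in>incident_edges (complete_edges n) v. y e\<bar> \<le> 7 * int n"
      using y0(2)[OF v] by simp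
    define S where "S = cross {v} (beaten n (cls v))"
    have vS: "v \<in> quad n (cls v)" using v by (simp add: quad_def)
    have vb: "v \<notin> beaten n (cls v)" by (simp add: beaten_def beats_def)
    have sub: "S \<subseteq> incident_edges (complete_edges n) v"
      unfolding S_def incident_complete[OF v] cross_def using vb by (auto simp: beaten_def)
    have "segmented y S"
    proof (cases "v \<in> L")
      case True
      then have c: "cls v = ?q" using L by (auto simp: quad_def)
      have "segmented y0 S" using y0(3)[OF True] by (simp add: S_def c)
      moreover have "S \<subseteq> B" using True by (auto simp: S_def c B_def cross_def)
      ultimately show ?thesis using segmented_cong[of S y y0] y(2) by blast
    next
      case False
      then have "S \<in> \<S>" using vS cls_le[OF v] unfolding \<S>_def S_def
        by (cases "cls v = ?q") auto
      then show ?thesis using y(4) by blast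
    qed
    moreover have "2 * card (incident_edges (complete_edges n) v - S) \<le> n + 12"
    proof -
      have "finite (incident_edges (complete_edges n) v)"
        using finite_complete_edges by (simp add: incident_edges_def)
      then have "card (incident_edges (complete_edges n) v - S) = n - 1 - card (beaten n (cls v))"
        using card_Diff_subset[OF finite_subset[OF sub] sub] v vb
        by (simp add: card_incident_complete S_def card_star)
      \<comment> \<open>For a full class with \<open>s\<close> wins,
        \<open>q \<le> 2 * s + 2\<close> is multiplied by 4, where \<open>4 * s\<close> is the size
        of the beaten set. Together with \<open>n \<le> 4 * q + 3\<close> this gives 8 + 3 =
        11.\<close>
      moreover have "n \<le> 2 * card (beaten n (cls v)) + 11"
      proof (cases "cls v = ?q")
        case True
        then have "card (beaten n (cls v)) = 4 * ?q" by (simp add: beaten_last)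
        then show ?thesis by linarith
      next
        case False
        then have "cls v < ?q" using cls_le[OF v] by simp
        from card_beats_ge[OF this] show ?thesis using card_beaten[of n "cls v"] by linarith
      qed
      ultimately show ?thesis by linarith
    qed
    ultimately show "\<exists>S \<subseteq> incident_edges (complete_edges n) v. segmented y S \<and>
       2 * card (incident_edges (complete_edges n) v - S) \<le> n + 12"
      using sub by blast
  qed
qed


section \<open>Robustness\<close>

text \<open>On the segmented part the displacement is of order \<open>p * p\<close>; only the other
  edges, about half of those at \<open>v\<close>, are charged \<open>p\<close> each. Everything is
  doubled to keep that half in the integers.\<close>

lemma vertex_sum_displacement:
  assumes y: "centred (complete_edges n) y"
    and ty: "\<And>e. e \<in> complete_edges n \<Longrightarrow> 2 * int (t e) = y e + int (card (complete_edges n)) + 1"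
    and t: "edge_labeling (complete_edges n) t"
    and t': "t' \<in> swap_results (complete_edges n) p t"
    and S: "S \<subseteq> incident_edges (complete_edges n) v" "segmented y S"
      "2 * card (incident_edges (complete_edges n) v - S) \<le> n + 12"
  shows "2 * \<bar>int (vertex_sum (complete_edges n) t' v) - int (vertex_sum (complete_edges n) t v)\<bar>
    \<le> 32 * (int p)\<^sup>2 + int p * (int n + 12)"
proof -
  let ?E = "complete_edges n" and ?D = "incident_edges (complete_edges n) v"
  have close: "\<bar>int (t e) - int (t' e)\<bar> \<le> int p" if "e \<in> ?E" for e
    using t' that by (auto simp: swap_results_def)
  have bij: "bij_betw t ?E {1..card ?E}" "bij_betw t' ?E {1..card ?E}"
    using t t' by (auto simp: swap_results_def edge_labeling_def)
  have DE: "?D \<subseteq> ?E" by (auto simp: incident_edges_def)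
  have fin: "finite ?D" using finite_complete_edges DE by (rule finite_subset[rotated])
  have "\<bar>\<Sum>e\<in>S. int (t' e) - int (t e)\<bar> \<le> 16 * (int p)\<^sup>2"
    using segmented_displacement[OF y ty bij close _ S(2)] S(1) DE by blast
  moreover have "2 * \<bar>\<Sum>e\<in>?D - S. int (t' e) - int (t e)\<bar> \<le> int p * (int n + 12)"
  proof -
    have "\<bar>\<Sum>e\<in>?D - S. int (t' e) - int (t e)\<bar> \<le> (\<Sum>e\<in>?D - S. int p)"
      by (rule order.trans[OF sum_abs], rule sum_mono)
        (use close DE in \<open>auto simp: abs_minus_commute\<close>)
    then have "2 * \<bar>\<Sum>e\<in>?D - S. int (t' e) - int (t e)\<bar> \<le> int p * int (2 * card (?D - S))"
      by (simp add: mult.commute)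
    also have "\<dots> \<le> int p * int (n + 12)" by (intro mult_left_mono) (use S(3) in linarith)+
    finally show ?thesis by simp
  qed
  moreover have "int (vertex_sum ?E t' v) - int (vertex_sum ?E t v)
      = (\<Sum>e\<in>?D - S. int (t' e) - int (t e)) + (\<Sum>e\<in>S. int (t' e) - int (t e))"
    using sum.subset_diff[OF S(1) fin, of "\<lambda>e. int (t' e) - int (t e)"]
    by (simp add: vertex_sum_def sum_subtractf)
  \<comment> \<open>The nonlinear terms are abstracted to variables, so that the combination becomes
    linear.\<close>
  moreover have "2 * \<bar>c\<bar> \<le> 32 * P + Q" if "\<bar>a\<bar> \<le> 16 * P" "2 * \<bar>b\<bar> \<le> Q" "c = b + a"
    for a b c P Q :: int
    using that by linarith
  ultimately show ?thesis by blast
qed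

text \<open>What needs care is that both maxima are taken over finite nonempty sets. The set of swap
  results is infinite, since values off the edge set are arbitrary, but the gaps take finitely many
  values because every vertex sum is at most the square of the number of edges.\<close>

lemma robustness_le:
  assumes n: "n \<ge> 2" and t: "edge_labeling (complete_edges n) t"
    and bound: "\<And>t' u v. t' \<in> swap_results (complete_edges n) p t \<Longrightarrow> u \<in> {1..n} \<Longrightarrow> v \<in> {1..n} \<Longrightarrow>
      \<bar>real (vertex_sum (complete_edges n) t' u) - real (vertex_sum (complete_edges n) t' v)\<bar> \<le> B"
  shows "robustness p t n \<le> B"
proof -
  let ?E = "complete_edges n"
  define W where "W = {..card ?E * card ?E}"
  define gaps where "gaps t' = {\<bar>real (vertex_sum ?E t' u) - real (vertex_sum ?E t' v)\<bar> | u v.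
      u \<in> {1..n} \<and> v \<in> {1..n} \<and> u \<noteq> v}" for t'
  have fin: "finite (gaps t')" for t'
    by (rule finite_subset[of _ "(\<lambda>(u, v). \<bar>real (vertex_sum ?E t' u) - real (vertex_sum ?E t' v)\<bar>) `
          ({1..n} \<times> {1..n})"]) (auto simp: gaps_def)
  have ne: "gaps t' \<noteq> {}" for t'
  proof -
    have "\<bar>real (vertex_sum ?E t' 1) - real (vertex_sum ?E t' 2)\<bar> \<in> gaps t'"
      unfolding gaps_def using n by (intro CollectI exI[of _ 1] exI[of _ 2]) auto
    then show ?thesis by blast
  qed
  have gap: "max_sum_gap {1..n} ?E t' = Max (gaps t')" for t'
    by (simp add: max_sum_gap_def gaps_def)
  have vs: "vertex_sum ?E t' v \<in> W" if "edge_labeling ?E t'" for t' v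
  proof -
    have "vertex_sum ?E t' v \<le> (\<Sum>e\<in>incident_edges ?E v. card ?E)"
      unfolding vertex_sum_def using that
      by (intro sum_mono) (auto simp: edge_labeling_def incident_edges_def dest!: bij_betwE)
    also have "\<dots> \<le> card ?E * card ?E"
      by (auto simp: incident_edges_def intro!: card_mono finite_complete_edges)
    finally show ?thesis by (simp add: W_def)
  qed
  have "max_sum_gap {1..n} ?E ` swap_results ?E p t \<subseteq> (\<lambda>(a, b). \<bar>real a - real b\<bar>) ` (W \<times> W)"
  proof clarify
    fix t' assume t': "t' \<in> swap_results ?E p t"
    have "max_sum_gap {1..n} ?E t' \<in> gaps t'" unfolding gap by (rule Max_in[OF fin ne])
    then obtain u v where "max_sum_gap {1..n} ?E t' = \<bar>real (vertex_sum ?E t' u) - real (vertex_sum ?E t' v)\<bar>"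
      unfolding gaps_def by blast
    moreover have "edge_labeling ?E t'" using t' by (simp add: swap_results_def)
    ultimately show "max_sum_gap {1..n} ?E t' \<in> (\<lambda>(a, b). \<bar>real a - real b\<bar>) ` (W \<times> W)"
      using vs by (intro image_eqI[of _ _ "(vertex_sum ?E t' u, vertex_sum ?E t' v)"]) auto
  qed
  then have fin': "finite (max_sum_gap {1..n} ?E ` swap_results ?E p t)"
    by (rule finite_subset) (simp add: W_def)
  have "t \<in> swap_results ?E p t" using t by (simp add: swap_results_def)
  moreover have "max_sum_gap {1..n} ?E t' \<le> B" if t': "t' \<in> swap_results ?E p t" for t'
    unfolding gap using bound[OF t'] by (intro Max.boundedI[OF fin ne]) (auto simp: gaps_def)
  ultimately show ?thesis
    unfolding robustness_def by (intro Max.boundedI[OF fin']) auto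
qed

text \<open>Passing from centred values to labels adds the same constant to every doubled vertex
  sum, because all degrees are \<open>n - 1\<close>; it cancels in differences. After a swap the gap
  is at most the original one plus the displacements at the two vertices.\<close>

lemma ex_robust_edge_labeling:
  assumes n: "n \<ge> 2"
  shows "\<exists>t. edge_labeling (complete_edges n) t \<and>
    almost_supermagic {1..n} (complete_edges n) (7 * real n) t \<and>
    (\<forall>p. robustness p t n \<le> 7 * real n + 32 * (real p)\<^sup>2 + real p * (real n + 12))"
proof -
  let ?E = "complete_edges n"
  define m where "m = int (card ?E)"
  obtain y where y: "centred ?E y"
    and dev: "\<And>v. v \<in> {1..n} \<Longrightarrow> \<bar>\<Sum>e\<in>incident_edges ?E v. y e\<bar> \<le> 7 * int n"
    and seg: "\<And>v. v \<in> {1..n} \<Longrightarrow> \<exists>S \<subseteq> incident_edges ?E v. segmented y S \<and>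
       2 * card (incident_edges ?E v - S) \<le> n + 12"
    by (rule ex_robust_labelling[of n]) (rule that)
  have bij: "bij_betw y ?E {z. \<bar>z\<bar> < m \<and> odd (z + m)}"
    using y by (simp add: centred_def m_def)
  define t where "t = (\<lambda>e. nat ((y e + m + 1) div 2))"
  have ty: "2 * int (t e) = y e + int (card ?E) + 1" if "e \<in> ?E" for e
  proof -
    have "\<bar>y e\<bar> < m" "odd (y e + m)" using bij that by (auto dest!: bij_betwE)
    moreover from this have "2 * ((y e + m + 1) div 2) = y e + m + 1"
      by (intro dvd_mult_div_cancel) simp
    ultimately show ?thesis by (simp add: t_def m_def)
  qed
  have lab: "edge_labeling ?E t"
  proof -
    have "bij_betw (\<lambda>z. nat ((z + m + 1) div 2)) {z. \<bar>z\<bar> < m \<and> odd (z + m)} {1..card ?E}"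
    proof (rule bij_betwI[where g = "\<lambda>k. 2 * int k - m - 1"])
      show "(\<lambda>z. nat ((z + m + 1) div 2)) \<in> {z. \<bar>z\<bar> < m \<and> odd (z + m)} \<rightarrow> {1..card ?E}"
        by (auto simp: m_def)
      show "(\<lambda>k. 2 * int k - m - 1) \<in> {1..card ?E} \<rightarrow> {z. \<bar>z\<bar> < m \<and> odd (z + m)}"
        by (auto simp: m_def)
      show "2 * int (nat ((z + m + 1) div 2)) - m - 1 = z" if "z \<in> {z. \<bar>z\<bar> < m \<and> odd (z + m)}" for z
      proof -
        have "2 * ((z + m + 1) div 2) = z + m + 1"
          using that by (intro dvd_mult_div_cancel) simp
        moreover from this have "(z + m + 1) div 2 \<ge> 0" using that by auto
        ultimately show ?thesis by (simp only: int_nat_eq if_True)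
      qed
    qed auto
    from bij_betw_trans[OF bij this] show ?thesis
      by (simp add: edge_labeling_def t_def comp_def)
  qed
  have sum: "2 * int (vertex_sum ?E t v) = (\<Sum>e\<in>incident_edges ?E v. y e) + (int n - 1) * (m + 1)"
    if v: "v \<in> {1..n}" for v
  proof -
    have "2 * int (vertex_sum ?E t v) = (\<Sum>e\<in>incident_edges ?E v. 2 * int (t e))"
      by (simp add: vertex_sum_def sum_distrib_left)
    also have "\<dots> = (\<Sum>e\<in>incident_edges ?E v. y e + (m + 1))"
      by (rule sum.cong) (auto simp: ty incident_edges_def m_def)
    also have "\<dots> = (\<Sum>e\<in>incident_edges ?E v. y e) + int (card (incident_edges ?E v)) * (m + 1)"
      by (simp add: sum.distrib)
    finally show ?thesis using card_incident_complete[OF v] n by (simp add: of_nat_diff)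
  qed
  \<comment> \<open>The doubled sums deviate by at most \<open>7 * n\<close> each from a common
    value, so they differ by at most \<open>14 * n\<close>, and the sums themselves by half of
    that.\<close>
  have gap: "\<bar>int (vertex_sum ?E t u) - int (vertex_sum ?E t v)\<bar> \<le> 7 * int n"
    if "u \<in> {1..n}" "v \<in> {1..n}" for u v
    using sum[OF that(1)] sum[OF that(2)] dev[OF that(1)] dev[OF that(2)] by linarith
  have "almost_supermagic {1..n} ?E (7 * real n) t"
    unfolding almost_supermagic_def
  proof (intro ballI)
    fix u v assume "u \<in> {1..n}" "v \<in> {1..n}"
    from gap[OF this] show "\<bar>real (vertex_sum ?E t u) - real (vertex_sum ?E t v)\<bar> \<le> 7 * real n"
      by linarith
  qed
  moreover have "robustness p t n \<le> 7 * real n + 32 * (real p)\<^sup>2 + real p * (real n + 12)" for p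
  proof (rule robustness_le[OF n lab])
    fix t' u v assume t': "t' \<in> swap_results ?E p t" and u: "u \<in> {1..n}" and v: "v \<in> {1..n}"
    have disp: "2 * \<bar>int (vertex_sum ?E t' w) - int (vertex_sum ?E t w)\<bar>
        \<le> 32 * (int p)\<^sup>2 + int p * (int n + 12)" if w: "w \<in> {1..n}" for w
      using seg[OF w] vertex_sum_displacement[OF y ty lab t'] by blast
    \<comment> \<open>The displacement bound is for the doubled displacement, so \<open>u\<close>
      and \<open>v\<close> together cost it once.\<close>
    have "\<bar>int (vertex_sum ?E t' u) - int (vertex_sum ?E t' v)\<bar>
        \<le> 7 * int n + 32 * (int p)\<^sup>2 + int p * (int n + 12)"
      using disp[OF u] disp[OF v] gap[OF u v] by (smt (verit))
    then have "real_of_int \<bar>int (vertex_sum ?E t' u) - int (vertex_sum ?E t' v)\<bar>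
        \<le> real_of_int (7 * int n + 32 * (int p)\<^sup>2 + int p * (int n + 12))"
      by (simp only: of_int_le_iff)
    then show "\<bar>real (vertex_sum ?E t' u) - real (vertex_sum ?E t' v)\<bar>
        \<le> 7 * real n + 32 * (real p)\<^sup>2 + real p * (real n + 12)"
      by simp
  qed
  ultimately show ?thesis using lab by blast
qed

text \<open>Divided by \<open>2 * p * n\<close>, the main term \<open>p * n\<close> gives 1/2. The
  initial gap gives \<open>7 / (2 * p)\<close>, which vanishes because \<open>p\<close> diverges;
  the quadratic term gives \<open>16 * p / n\<close>, which vanishes because \<open>p\<close> is
  o(n); the remaining edges give \<open>6 / n\<close>.\<close>

lemma robustness_ratio_le_half:
  assumes p: "admissible p"
    and t: "\<And>n. n \<ge> 2 \<Longrightarrow>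
      robustness (p n) (t n) n \<le> 7 * real n + 32 * (real (p n))\<^sup>2 + real (p n) * (real n + 12)"
  shows "robustness_ratio p t \<le> ereal (1 / 2)"
proof -
  have small: "(\<lambda>n. real (p n) / real n) \<longlonglongrightarrow> 0"
    using p unfolding admissible_def by (auto dest: smalloD_tendsto)
  have "filterlim (\<lambda>n. real (p n)) at_top sequentially"
    using p unfolding admissible_def by (auto intro: filterlim_compose[OF filterlim_real_sequentially])
  then have inv: "(\<lambda>n. inverse (real (p n))) \<longlonglongrightarrow> 0"
    by (rule tendsto_inverse_0_at_top)
  define g where "g n = 7 / 2 * inverse (real (p n)) + 16 * (real (p n) / real n) + 1 / 2 + 6 * inverse (real n)"
    for n
  have "g \<longlonglongrightarrow> 7 / 2 * 0 + 16 * 0 + 1 / 2 + 6 * 0"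
    unfolding g_def by (intro tendsto_intros inv small lim_inverse_n)
  then have g: "(\<lambda>n. ereal (g n)) \<longlonglongrightarrow> ereal (1 / 2)" by simp
  have "eventually (\<lambda>n. p n \<ge> 1) sequentially"
    using p unfolding admissible_def filterlim_at_top by blast
  then have "eventually (\<lambda>n. ereal (robustness (p n) (t n) n / (2 * real (p n) * real n)) \<le> ereal (g n))
      sequentially"
    using eventually_ge_at_top[of 2]
  proof eventually_elim
    case (elim n)
    then have pos: "2 * real (p n) * real n > 0" by simp
    have "robustness (p n) (t n) n / (2 * real (p n) * real n)
        \<le> (7 * real n + 32 * (real (p n))\<^sup>2 + real (p n) * (real n + 12)) / (2 * real (p n) * real n)"
      using t[OF elim(2)] pos by (intro divide_right_mono) auto
    also have "\<dots> = g n"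
    proof -
      have "real (p n) \<noteq> 0" "real n \<noteq> 0" using elim by auto
      then show ?thesis by (simp add: g_def field_simps power2_eq_square)
    qed
    finally show ?case by simp
  qed
  then have "robustness_ratio p t \<le> limsup (\<lambda>n. ereal (g n))"
    unfolding robustness_ratio_def by (rule Limsup_mono)
  also have "\<dots> = ereal (1 / 2)" using g by (intro lim_imp_Limsup) auto
  finally show ?thesis .
qed

theorem theorem7p1:
  fixes \<epsilon> :: real
  assumes "\<epsilon> > 0"
  shows "\<exists>(N::nat) (t :: nat \<Rightarrow> nat set \<Rightarrow> nat).
    (\<forall>n\<ge>N. edge_labeling (complete_edges n) (t n) \<and>
            almost_supermagic {1..n} (complete_edges n) (7 * real n) (t n)) \<and>
    (\<forall>p. admissible p \<longrightarrow> robustness_ratio p t \<le> ereal (1 / 2 + \<epsilon>))"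
proof -
  \<comment> \<open>The labelings are chosen for each \<open>n\<close> before any \<open>p\<close>
    is given, so one family serves every admissible \<open>p\<close>.\<close>
  obtain t where t: "edge_labeling (complete_edges n) (t n)"
    "almost_supermagic {1..n} (complete_edges n) (7 * real n) (t n)"
    "robustness p (t n) n \<le> 7 * real n + 32 * (real p)\<^sup>2 + real p * (real n + 12)"
    if "n \<ge> 2" for n p
    using ex_robust_edge_labeling by metis
  have "robustness_ratio p t \<le> ereal (1 / 2 + \<epsilon>)" if "admissible p" for p
  proof -
    have "robustness_ratio p t \<le> ereal (1 / 2)"
      using that by (rule robustness_ratio_le_half) (rule t(3))
    also have "\<dots> \<le> ereal (1 / 2 + \<epsilon>)" using assms by simp
    finally show ?thesis .
  qed
  then show ?thesis using t(1,2) by blast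
qed

end
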